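(* Let $V$ be a C$^*$-ordered operator space. Then the map $\Gamma: V\to A_0(Q_1(V),V^* )$, $\Gamma(v)=\hat v$, where $\hat v(f)=f(v)$ for $f\in Q_1(V)$, is a surjective, complete isometric, complete order isomorphism; that is, $\Gamma$ is a linear bijection commuting with the involutions and, for every $n\in\mathbb{N}$, the map $\Gamma_n: M_n(V)\to M_n(A_0(Q_1(V),V^* ))$, $[v_{ij}]\mapsto[\widehat{v_{ij}}]$, is isometric and both $\Gamma_n$ and $\Gamma_n^{-1}$ are positive, where the norm and the cone on $M_n(A_0(Q_1(V),V^* ))$ are those of $A_0(Q_n(V),M_n(V^* ))$ under the identification described in the context.
   Context: For a complex $*$-vector space $V$, $V_{sa}$ is the set of self-adjoint elements, and $M_n(V)$ is a $*$-vector space with $[v_{ij}]^*=[v_{ji}^*]$. A cone is a subset of the self-adjoint part closed under addition and under multiplication by nonnegative reals. $V$ is matrix ordered if each $M_n(V)_{sa}$ carries a cone $M_n(V)^+$ with $\gamma^*M_m(V)^+\gamma\subseteq M_n(V)^+$ for all scalar $m\times n$ matrices $\gamma$; $u\le v$ means $v-u\in M_n(V)^+$. $V^+=M_1(V)^+$ is proper if $V^+\cap(-V^+)=\{0\}$. An abstract operator space is a complex vector space $V$ with norms $\|\cdot\|_n$ on $M_n(V)$ such that $\|v\oplus w\|_{n+m}=\max\{\|v\|_n,\|w\|_m\}$ and $\|\alpha v\beta\|_n\le\|\alpha\|\,\|v\|_n\|\beta\|$ for scalar matrices $\alpha,\beta$. A C$^*$-ordered operator space is a matrix ordered $*$-vector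 space $V$ with matrix norms making it an abstract operator space, such that $V^+$ is proper and for each $n$: (1) $*$ is an isometry on $M_n(V)$; (2) $M_n(V)^+$ is norm closed; (3) $\|g\|_n\le\max\{\|f\|_n,\|h\|_n\}$ whenever $f\le g\le h$ in $M_n(V)_{sa}$. $V^*$ is the Banach dual of $V$, with $f^*(v)=\overline{f(v^* )}$. $M_n(V^* )$ is identified with the dual of $M_n(V)$ by the pairing $[f_{ij}]([v_{ij}])=\sum_{i,j}f_{ij}(v_{ij})$, carries the dual norm $\|\cdot\|_n$, the $w^*$-topology, and the cone $M_n(V^* )^+=\{f\in M_n(V^* )_{sa}: f(v)\ge0\ \forall v\in M_n(V)^+\}$. Put $Q_n(V)=\{f\in M_n(V^* )^+:\|f\|_n\le1\}$. $A_0(Q_n(V),M_n(V^* ))$ is the space of all $w^*$-continuous affine maps $a:Q_n(V)\to\mathbb{C}$ with $a(0)=0$ that have a unique $w^*$-continuous linear extension $\tilde a$ to $M_n(V^* )$. Its involution is $a^*(f)=\overline{a(f)}$ for $f\in Q_n(V)$, and its cone is the set of self-adjoint $a$ with $a(f)\ge0$ for all $f\in Q_n(V)$. $M_n(A_0(Q_1(V),V^* ))$ is identified with $A_0(Q_n(V),M_n(V^* ))$ by letting $[a_{ij}]$ act as $[f_{ij}]\mapsto\sum_{i,j}\widetilde{a_{ij}}(f_{ij})$. The norm on $A_0(Q_n(V),M_n(V^* ))$ is $\|a\|_{\infty,n}=\sup\{|\tilde a(f_{12})+\widetilde{a^*}(f_{12}^* )|: f=\begin{bmatrix}f_{11}&f_{12}\\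 f_{12}^*&f_{22}\end{bmatrix}\in Q_{2n}(V)\}$, i.e. the supremum over $f\in Q_{2n}(V)$ of the absolute value of $\begin{bmatrix}0&a\\ a^*&0\end{bmatrix}$ evaluated at $f$. *)

theory Defs
  imports
    "HOL-Analysis.Function_Topology"
    "HOL-Analysis.L2_Norm"
    "HOL-Library.Function_Algebras"
    "HOL-Library.Nonpos_Ints"
    "Jordan_Normal_Form.Matrix"
begin

text \<open>
  The underlying space \<open>V\<close> is a whole type \<open>'v\<close>. \<open>M\<^sub>n(V)\<close> is \<^term>\<open>carrier_mat n n :: 'v mat set\<close>,
  with \<open>n\<close> ranging over the positive integers; the fields \<open>mnorm V 0\<close> and \<open>mcone V 0\<close>
  are meaningless and never constrained. \<open>V\<close> itself is identified with \<open>M\<^sub>1(V)\<close> through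
  \<open>mat11\<close>, so \<open>V\<^sup>+\<close> is \<open>mcone V 1\<close>.
\<close>

record 'v matrix_space =
  vscale :: "complex \<Rightarrow> 'v \<Rightarrow> 'v"
  vstar :: "'v \<Rightarrow> 'v"
  mnorm :: "nat \<Rightarrow> 'v mat \<Rightarrow> real"
  mcone :: "nat \<Rightarrow> 'v mat set"

definition mat11 :: "'a \<Rightarrow> 'a mat"
  where "mat11 x = Matrix.mat 1 1 (\<lambda>_. x)"

text \<open>\<open>[x\<^sub>i\<^sub>j]\<^sup>* = [x\<^sub>j\<^sub>i\<^sup>*]\<close> for an arbitrary entrywise involution; with \<^const>\<open>cnj\<close> it is
  the adjoint of a scalar matrix.\<close>

definition mat_star :: "('a \<Rightarrow> 'a) \<Rightarrow> 'a mat \<Rightarrow> 'a mat"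
  where "mat_star s A = map_mat s (transpose_mat A)"

definition mat_sa :: "('a \<Rightarrow> 'a) \<Rightarrow> nat \<Rightarrow> 'a mat set"
  where "mat_sa s n = {A \<in> carrier_mat n n. mat_star s A = A}"

definition scalar_mult_left ::
  "('v::ab_group_add) matrix_space \<Rightarrow> complex mat \<Rightarrow> 'v mat \<Rightarrow> 'v mat"
  where "scalar_mult_left V \<alpha> A = Matrix.mat (dim_row \<alpha>) (dim_col A)
    (\<lambda>(i, j). \<Sum>k<dim_col \<alpha>. vscale V (\<alpha> $$ (i, k)) (A $$ (k, j)))"

definition scalar_mult_right ::
  "('v::ab_group_add) matrix_space \<Rightarrow> 'v mat \<Rightarrow> complex mat \<Rightarrow> 'v mat"
  where "scalar_mult_right V A \<beta> = Matrix.mat (dim_row A) (dim_col \<beta>)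
    (\<lambda>(i, j). \<Sum>k<dim_row \<beta>. vscale V (\<beta> $$ (k, j)) (A $$ (i, k)))"

text \<open>The operator norm of a scalar matrix for the Euclidean norms.\<close>

definition euclidean_norm_vec :: "complex Matrix.vec \<Rightarrow> real"
  where "euclidean_norm_vec x = L2_set (\<lambda>i. cmod (vec_index x i)) {..<dim_vec x}"

definition scalar_mat_norm :: "complex mat \<Rightarrow> real"
  where "scalar_mat_norm \<alpha> =
    Sup {euclidean_norm_vec (\<alpha> *\<^sub>v x) |x. x \<in> carrier_vec (dim_col \<alpha>) \<and> euclidean_norm_vec x \<le> 1}"


locale star_vector_space =
  fixes V :: "('v::ab_group_add) matrix_space"
  assumes vector_space: "vector_space (vscale V)"
    and star_add: "vstar V (v + w) = vstar V v + vstar V w"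
    and star_scale: "vstar V (vscale V c v) = vscale V (cnj c) (vstar V v)"
    and star_star: "vstar V (vstar V v) = v"

locale matrix_ordered = star_vector_space V for V :: "('v::ab_group_add) matrix_space" +
  assumes cone_sa: "0 < n \<Longrightarrow> mcone V n \<subseteq> mat_sa (vstar V) n"
    and cone_add: "\<lbrakk>0 < n; A \<in> mcone V n; B \<in> mcone V n\<rbrakk> \<Longrightarrow> A + B \<in> mcone V n"
    and cone_scale: "\<lbrakk>0 < n; A \<in> mcone V n; 0 \<le> r\<rbrakk>
      \<Longrightarrow> map_mat (vscale V (complex_of_real r)) A \<in> mcone V n"
    and cone_compress: "\<lbrakk>0 < m; 0 < n; \<gamma> \<in> carrier_mat m n; A \<in> mcone V m\<rbrakk>
      \<Longrightarrow> scalar_mult_right V (scalar_mult_left V (mat_star cnj \<gamma>) A) \<gamma> \<in> mcone V n"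

locale abstract_operator_space =
  fixes V :: "('v::ab_group_add) matrix_space"
  assumes vector_space: "vector_space (vscale V)"
    and norm_eq_0: "\<lbrakk>0 < n; A \<in> carrier_mat n n\<rbrakk> \<Longrightarrow> mnorm V n A = 0 \<longleftrightarrow> A = 0\<^sub>m n n"
    and norm_triangle: "\<lbrakk>0 < n; A \<in> carrier_mat n n; B \<in> carrier_mat n n\<rbrakk>
      \<Longrightarrow> mnorm V n (A + B) \<le> mnorm V n A + mnorm V n B"
    and norm_scale: "\<lbrakk>0 < n; A \<in> carrier_mat n n\<rbrakk>
      \<Longrightarrow> mnorm V n (map_mat (vscale V c) A) = cmod c * mnorm V n A"
    and norm_direct_sum: "\<lbrakk>0 < n; 0 < m; A \<in> carrier_mat n n; B \<in> carrier_mat m m\<rbrakk>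
      \<Longrightarrow> mnorm V (n + m) (four_block_mat A (0\<^sub>m n m) (0\<^sub>m m n) B) = max (mnorm V n A) (mnorm V m B)"
    and norm_scalar_mult: "\<lbrakk>0 < n; \<alpha> \<in> carrier_mat n n; \<beta> \<in> carrier_mat n n; A \<in> carrier_mat n n\<rbrakk>
      \<Longrightarrow> mnorm V n (scalar_mult_right V (scalar_mult_left V \<alpha> A) \<beta>)
        \<le> scalar_mat_norm \<alpha> * mnorm V n A * scalar_mat_norm \<beta>"

locale cstar_ordered_operator_space = matrix_ordered V + abstract_operator_space V
  for V :: "('v::ab_group_add) matrix_space" +
  assumes proper: "mcone V 1 \<inter> uminus ` mcone V 1 = {0\<^sub>m 1 1}"
    and star_isometry: "\<lbrakk>0 < n; A \<in> carrier_mat n n\<rbrakk>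
      \<Longrightarrow> mnorm V n (mat_star (vstar V) A) = mnorm V n A"
    and cone_closed: "\<lbrakk>0 < n; \<And>k. X k \<in> mcone V n; A \<in> carrier_mat n n;
        (\<lambda>k. mnorm V n (X k - A)) \<longlonglongrightarrow> 0\<rbrakk> \<Longrightarrow> A \<in> mcone V n"
    and norm_between: "\<lbrakk>0 < n; F \<in> mat_sa (vstar V) n; G \<in> mat_sa (vstar V) n; H \<in> mat_sa (vstar V) n;
        G - F \<in> mcone V n; H - G \<in> mcone V n\<rbrakk>
      \<Longrightarrow> mnorm V n G \<le> max (mnorm V n F) (mnorm V n H)"


definition dual_space :: "('v::ab_group_add) matrix_space \<Rightarrow> ('v \<Rightarrow> complex) set"
  where "dual_space V = {\<phi>. Vector_Spaces.linear (vscale V) (*) \<phi> \<and>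
    (\<exists>C. \<forall>v. cmod (\<phi> v) \<le> C * mnorm V 1 (mat11 v))}"

definition dual_scale :: "complex \<Rightarrow> ('v \<Rightarrow> complex) \<Rightarrow> 'v \<Rightarrow> complex"
  where "dual_scale c \<phi> = (\<lambda>v. c * \<phi> v)"

definition dual_star :: "('v::ab_group_add) matrix_space \<Rightarrow> ('v \<Rightarrow> complex) \<Rightarrow> 'v \<Rightarrow> complex"
  where "dual_star V \<phi> = (\<lambda>v. cnj (\<phi> (vstar V v)))"

definition mat_dual :: "('v::ab_group_add) matrix_space \<Rightarrow> nat \<Rightarrow> ('v \<Rightarrow> complex) mat set"
  where "mat_dual V n = {f \<in> carrier_mat n n. \<forall>i<n. \<forall>j<n. f $$ (i, j) \<in> dual_space V}"

definition mat_pairing :: "nat \<Rightarrow> ('v \<Rightarrow> complex) mat \<Rightarrow> 'v mat \<Rightarrow> complex"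
  where "mat_pairing n f A = (\<Sum>i<n. \<Sum>j<n. (f $$ (i, j)) (A $$ (i, j)))"

definition dual_norm :: "('v::ab_group_add) matrix_space \<Rightarrow> nat \<Rightarrow> ('v \<Rightarrow> complex) mat \<Rightarrow> real"
  where "dual_norm V n f =
    Sup {cmod (mat_pairing n f A) |A. A \<in> carrier_mat n n \<and> mnorm V n A \<le> 1}"

text \<open>The topology of pointwise convergence on \<open>M\<^sub>n(V)\<close>.\<close>

definition wstar_topology ::
  "('v::ab_group_add) matrix_space \<Rightarrow> nat \<Rightarrow> ('v \<Rightarrow> complex) mat topology"
  where "wstar_topology V n =
    pullback_topology (mat_dual V n) (\<lambda>f. \<lambda>A\<in>carrier_mat n n. mat_pairing n f A)
      (product_topology (\<lambda>_. euclidean) (carrier_mat n n))"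

definition dual_cone :: "('v::ab_group_add) matrix_space \<Rightarrow> nat \<Rightarrow> ('v \<Rightarrow> complex) mat set"
  where "dual_cone V n = {f \<in> mat_dual V n. f \<in> mat_sa (dual_star V) n \<and>
    (\<forall>A\<in>mcone V n. mat_pairing n f A \<in> \<real>\<^sub>\<ge>\<^sub>0)}"

definition Q_set :: "('v::ab_group_add) matrix_space \<Rightarrow> nat \<Rightarrow> ('v \<Rightarrow> complex) mat set"
  where "Q_set V n = {f \<in> dual_cone V n. dual_norm V n f \<le> 1}"


text \<open>
  Functions on \<open>Q\<^sub>n(V)\<close> and on \<open>M\<^sub>n(V\<^sup>*)\<close> are normalised by \<^const>\<open>extensional\<close>, so that
  equality of HOL functions is equality on the domain; this is essential for the
  uniqueness of the extension in \<open>A0\<close>. The operations \<open>+\<close> and \<open>0\<close> on the entries of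
  matrices of functionals are the pointwise ones.
\<close>

definition is_wstar_linear_extension ::
  "('v::ab_group_add) matrix_space \<Rightarrow> nat \<Rightarrow> (('v \<Rightarrow> complex) mat \<Rightarrow> complex)
    \<Rightarrow> (('v \<Rightarrow> complex) mat \<Rightarrow> complex) \<Rightarrow> bool"
  where "is_wstar_linear_extension V n a b \<longleftrightarrow>
    b \<in> extensional (mat_dual V n) \<and>
    continuous_map (wstar_topology V n) euclidean b \<and>
    (\<forall>f\<in>mat_dual V n. \<forall>g\<in>mat_dual V n. b (f + g) = b f + b g) \<and>
    (\<forall>c. \<forall>f\<in>mat_dual V n. b (map_mat (dual_scale c) f) = c * b f) \<and>
    (\<forall>f\<in>Q_set V n. b f = a f)"

definition A0 ::
  "('v::ab_group_add) matrix_space \<Rightarrow> nat \<Rightarrow> (('v \<Rightarrow> complex) mat \<Rightarrow> complex) set"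
  where "A0 V n = {a \<in> extensional (Q_set V n).
    continuous_map (subtopology (wstar_topology V n) (Q_set V n)) euclidean a \<and>
    (\<forall>f\<in>Q_set V n. \<forall>g\<in>Q_set V n. \<forall>t. 0 \<le> t \<and> t \<le> 1 \<longrightarrow>
      a (map_mat (dual_scale (complex_of_real (1 - t))) f + map_mat (dual_scale (complex_of_real t)) g)
        = complex_of_real (1 - t) * a f + complex_of_real t * a g) \<and>
    a (0\<^sub>m n n) = 0 \<and>
    (\<exists>!b. is_wstar_linear_extension V n a b)}"

definition A0_ext ::
  "('v::ab_group_add) matrix_space \<Rightarrow> nat \<Rightarrow> (('v \<Rightarrow> complex) mat \<Rightarrow> complex)
    \<Rightarrow> ('v \<Rightarrow> complex) mat \<Rightarrow> complex"
  where "A0_ext V n a = (THE b. is_wstar_linear_extension V n a b)"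

definition A0_star ::
  "('v::ab_group_add) matrix_space \<Rightarrow> nat \<Rightarrow> (('v \<Rightarrow> complex) mat \<Rightarrow> complex)
    \<Rightarrow> ('v \<Rightarrow> complex) mat \<Rightarrow> complex"
  where "A0_star V n a = (\<lambda>f\<in>Q_set V n. cnj (a f))"

definition A0_cone ::
  "('v::ab_group_add) matrix_space \<Rightarrow> nat \<Rightarrow> (('v \<Rightarrow> complex) mat \<Rightarrow> complex) set"
  where "A0_cone V n = {a \<in> A0 V n. A0_star V n a = a \<and> (\<forall>f\<in>Q_set V n. a f \<in> \<real>\<^sub>\<ge>\<^sub>0)}"

definition A0_norm ::
  "('v::ab_group_add) matrix_space \<Rightarrow> nat \<Rightarrow> (('v \<Rightarrow> complex) mat \<Rightarrow> complex) \<Rightarrow> real"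
  where "A0_norm V n a =
    Sup {cmod (A0_ext V n a f12 + A0_ext V n (A0_star V n a) (mat_star (dual_star V) f12)) |f11 f12 f22.
      f11 \<in> carrier_mat n n \<and> f12 \<in> carrier_mat n n \<and> f22 \<in> carrier_mat n n \<and>
      four_block_mat f11 f12 (mat_star (dual_star V) f12) f22 \<in> Q_set V (2 * n)}"

definition mat_A0 ::
  "('v::ab_group_add) matrix_space \<Rightarrow> nat \<Rightarrow> (('v \<Rightarrow> complex) mat \<Rightarrow> complex) mat set"
  where "mat_A0 V n = {a \<in> carrier_mat n n. \<forall>i<n. \<forall>j<n. a $$ (i, j) \<in> A0 V 1}"

text \<open>The identification of \<open>M\<^sub>n(A\<^sub>0(Q\<^sub>1(V), V\<^sup>*))\<close> with \<open>A\<^sub>0(Q\<^sub>n(V), M\<^sub>n(V\<^sup>*))\<close>, along which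
  the norm and the cone are transported.\<close>

definition A0_ident ::
  "('v::ab_group_add) matrix_space \<Rightarrow> nat \<Rightarrow> (('v \<Rightarrow> complex) mat \<Rightarrow> complex) mat
    \<Rightarrow> ('v \<Rightarrow> complex) mat \<Rightarrow> complex"
  where "A0_ident V n a =
    (\<lambda>f\<in>Q_set V n. \<Sum>i<n. \<Sum>j<n. A0_ext V 1 (a $$ (i, j)) (mat11 (f $$ (i, j))))"

definition mat_A0_norm ::
  "('v::ab_group_add) matrix_space \<Rightarrow> nat \<Rightarrow> (('v \<Rightarrow> complex) mat \<Rightarrow> complex) mat \<Rightarrow> real"
  where "mat_A0_norm V n a = A0_norm V n (A0_ident V n a)"

definition mat_A0_cone ::
  "('v::ab_group_add) matrix_space \<Rightarrow> nat \<Rightarrow> (('v \<Rightarrow> complex) mat \<Rightarrow> complex) mat set"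
  where "mat_A0_cone V n = {a \<in> mat_A0 V n. A0_ident V n a \<in> A0_cone V n}"

definition Gamma ::
  "('v::ab_group_add) matrix_space \<Rightarrow> 'v \<Rightarrow> ('v \<Rightarrow> complex) mat \<Rightarrow> complex"
  where "Gamma V v = (\<lambda>f\<in>Q_set V 1. (f $$ (0, 0)) v)"

end

theory Submission
  imports Defs
begin

text \<open>
  The map \<open>\<Gamma>\<^sub>n\<close> sends \<open>A\<close> to evaluation at \<open>A\<close>, and every part of the theorem says that \<open>Q\<^sub>n(V)\<close>, the set of
  positive functionals of norm at most one, is large enough. Three facts carry the proof: \<open>Q\<^sub>n(V)\<close> norms
  the self-adjoint elements (\<open>Q_set_norming\<close>), it separates them from the cone
  (\<open>Q_set_separates_cone\<close>), and it spans \<open>M\<^sub>n(V\<^sup>*)\<close> (\<open>Q_set_spans_mat_dual\<close>).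

  All three come from one sublinear functional. For self-adjoint \<open>x\<close> let \<open>u(x) = inf {\<parallel>y\<parallel> | x \<le> y}\<close>
  (\<open>upper_norm\<close>). A real functional dominated by \<open>u\<close> is positive of norm at most one, and its
  complexification has the same norm because the involution is isometric. By the Hahn-Banach theorem some
  such functional takes the value \<open>u(x)\<close> at a given \<open>x\<close>. Now \<open>u(- x)\<close> is the distance of \<open>x\<close> from the
  cone, so closedness of the cone gives the separation. The bound \<open>\<parallel>g\<parallel> \<le> max \<parallel>f\<parallel> \<parallel>h\<parallel>\<close> for \<open>f \<le> g \<le> h\<close> says precisely that
  \<open>\<parallel>x\<parallel> \<le> max (u(x)) (u(- x))\<close> (\<open>norm_herm_le_upper_norm\<close>), which gives the norming property. It
  also shows that a bounded hermitian functional is dominated by a multiple of \<open>u(x) + u(- x)\<close>; an infimal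
  convolution then splits it into a difference of functionals dominated by multiples of \<open>u\<close>
  (\<open>linear_difference_of_dominated\<close>), so that \<open>Q\<^sub>n(V)\<close> spans.

  Spanning makes linear extensions from \<open>Q\<^sub>n(V)\<close> unique, hence evaluations lie in \<open>A\<^sub>0\<close>. Conversely the
  extension of an element of \<open>A\<^sub>0\<close> is \<open>w\<^sup>*\<close>-continuous and linear, and such functionals are evaluations
  (\<open>wstar_continuous_linear_is_pairing\<close>). This is bijectivity at every level, and at level one it makes
  the identification of matrices over \<open>A\<^sub>0(Q\<^sub>1(V), V\<^sup>*)\<close> with \<open>A\<^sub>0(Q\<^sub>n(V), M\<^sub>n(V\<^sup>*))\<close> a bijection as well.
  Positivity of the inverse is the separation property. For the isometry, the norm at level \<open>n\<close> pairs
  \<open>Q\<^sub>2\<^sub>n(V)\<close> with the self-adjoint matrix that has \<open>A\<close> and \<open>A\<^sup>*\<close> off the diagonal; by the norming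
  property at level \<open>2n\<close> it is the norm of that matrix, which is \<open>\<parallel>A\<parallel>\<close> (\<open>norm_off_diagonal\<close>).
\<close>

section \<open>Sublinear functionals on a real vector space\<close>

locale real_linear_space = Vector_Spaces.vector_space scale
  for scale :: "real \<Rightarrow> 'a::ab_group_add \<Rightarrow> 'a"
begin

text \<open>
  Homogeneity is only required as an inequality and only for positive factors; applied to both
  \<open>t\<close> and \<open>1 / t\<close> it gives equality on a cone.
\<close>

definition sublinear_on :: "'a set \<Rightarrow> ('a \<Rightarrow> real) \<Rightarrow> bool"
  where "sublinear_on C q \<longleftrightarrow> (\<forall>x\<in>C. \<forall>y\<in>C. q (x + y) \<le> q x + q y)
    \<and> (\<forall>t>0. \<forall>x\<in>C. q (scale t x) \<le> t * q x)"

abbreviation sublinear :: "('a \<Rightarrow> real) \<Rightarrow> bool"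
  where "sublinear \<equiv> sublinear_on UNIV"

definition convex_cone :: "'a set \<Rightarrow> bool"
  where "convex_cone C \<longleftrightarrow> 0 \<in> C \<and> (\<forall>x\<in>C. \<forall>y\<in>C. x + y \<in> C) \<and> (\<forall>t>0. \<forall>x\<in>C. scale t x \<in> C)"

lemma sublinear_add: "sublinear q \<Longrightarrow> q (x + y) \<le> q x + q y"
  by (simp add: sublinear_on_def)

lemma sublinear_scale:
  assumes "sublinear q" "t > 0"
  shows "q (scale t x) = t * q x"
proof (rule antisym)
  show "q (scale t x) \<le> t * q x"
    using assms by (simp add: sublinear_on_def)
  have "q (scale (inverse t) (scale t x)) \<le> inverse t * q (scale t x)"
    using assms unfolding sublinear_on_def by (meson UNIV_I positive_imp_inverse_positive)
  then have "q x \<le> inverse t * q (scale t x)"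
    using assms by simp
  then show "t * q x \<le> q (scale t x)"
    using assms by (simp add: field_simps)
qed

lemma sublinear_0: "sublinear q \<Longrightarrow> q 0 = 0"
  using sublinear_scale[where q = q and t = 2 and x = 0] by simp

lemma sublinear_minus: "sublinear q \<Longrightarrow> - q (- x) \<le> q x"
  using sublinear_add[of q x "- x"] sublinear_0[of q] by simp

text \<open>
  All sublinear functionals used below arise from a known one, \<open>q\<close>, by this construction: the
  least cost of moving \<open>x\<close> along a cone \<open>C\<close>, where a displacement \<open>c\<close> carries the price \<open>m c\<close>.
  With \<open>C\<close> a ray, the positive cone, or the whole space, it yields respectively the Hahn-Banach
  extension step, the norm of the elements above \<open>x\<close>, and the decomposition of functionals.
\<close>

lemma sublinear_inf_convolution:
  assumes q: "sublinear q" and C: "convex_cone C" and m: "sublinear_on C m" "m 0 \<le> 0"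
    and bdd: "\<And>x. \<exists>b. \<forall>c\<in>C. b \<le> q (x + c) + m c"
  defines "r \<equiv> (\<lambda>x. INF c\<in>C. q (x + c) + m c)"
  shows "sublinear r" and "\<And>x c. c \<in> C \<Longrightarrow> r x \<le> q (x + c) + m c" and "\<And>x. r x \<le> q x"
proof -
  have bb: "bdd_below ((\<lambda>c. q (x + c) + m c) ` C)" for x
    using bdd[of x] by (auto simp: bdd_below_def)
  have r_eq: "r x = (INF c\<in>C. q (x + c) + m c)" for x
    by (simp add: r_def)
  have ne: "C \<noteq> {}"
    using C by (auto simp: convex_cone_def)
  show le: "r x \<le> q (x + c) + m c" if "c \<in> C" for x c
    unfolding r_def by (rule cINF_lower[OF bb that])
  show "r x \<le> q x" for x
    using le[of 0 x] m C by (simp add: convex_cone_def)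
  have "r (x + y) \<le> r x + r y" for x y
  proof -
    have 1: "r (x + y) \<le> (q (x + c) + m c) + (q (y + d) + m d)" if "c \<in> C" "d \<in> C" for c d
    proof -
      have "r (x + y) \<le> q ((x + y) + (c + d)) + m (c + d)"
        using that C by (intro le) (auto simp: convex_cone_def)
      also have "q ((x + y) + (c + d)) \<le> q (x + c) + q (y + d)"
        using sublinear_add[OF q, of "x + c" "y + d"] by (simp add: ac_simps)
      also have "m (c + d) \<le> m c + m d"
        using that m by (simp add: sublinear_on_def)
      finally show ?thesis
        by linarith
    qed
    have "r (x + y) - (q (y + d) + m d) \<le> r x" if "d \<in> C" for d
      unfolding r_eq[of x] using 1[OF _ that] by (intro cINF_greatest[OF ne]) (simp add: algebra_simps)
    then have "r (x + y) - r x \<le> r y"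
      unfolding r_eq[of y] by (intro cINF_greatest[OF ne]) (simp add: algebra_simps)
    then show ?thesis
      by simp
  qed
  moreover have "r (scale t x) \<le> t * r x" if "t > 0" for t x
  proof -
    have "r (scale t x) / t \<le> q (x + c) + m c" if "c \<in> C" for c
    proof -
      have "r (scale t x) \<le> q (scale t x + scale t c) + m (scale t c)"
        using that C \<open>t > 0\<close> by (intro le) (auto simp: convex_cone_def)
      also have "\<dots> \<le> t * q (x + c) + t * m c"
        using sublinear_scale[OF q \<open>t > 0\<close>, of "x + c"] m that \<open>t > 0\<close>
        by (simp add: sublinear_on_def scale_right_distrib)
      finally show ?thesis
        using \<open>t > 0\<close> by (simp add: field_simps)
    qed
    then have "r (scale t x) / t \<le> r x"
      unfolding r_eq[of x] by (intro cINF_greatest[OF ne])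
    then show ?thesis
      using \<open>t > 0\<close> by (simp add: field_simps)
  qed
  ultimately show "sublinear r"
    by (simp add: sublinear_on_def)
qed

text \<open>
  A linear functional below such an \<open>r\<close> lies below \<open>q\<close> and agrees with it at \<open>x0\<close>: put \<open>x = - x0\<close>
  in the last inequality.
\<close>

lemma sublinear_ray_infimum:
  assumes "sublinear q"
  obtains r where "sublinear r" "\<And>x. r x \<le> q x" "\<And>x. r x \<le> q (x + x0) - q x0"
proof -
  define C where "C = {scale t x0 |t. 0 \<le> t}"
  define m where "m = (\<lambda>c. - q c)"
  have qC: "q (scale t x0) = t * q x0" if "0 \<le> t" for t
    using that sublinear_scale[OF assms, of t x0] sublinear_0[OF assms] by (cases "t = 0") auto
  have x0: "x0 \<in> C"
    unfolding C_def by (auto intro!: exI[of _ 1])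
  have C: "convex_cone C"
    unfolding convex_cone_def C_def
    by (auto simp: scale_left_distrib[symmetric] intro: exI[of _ 0] add_nonneg_nonneg mult_nonneg_nonneg less_imp_le)
  have "sublinear_on C m"
    unfolding sublinear_on_def
  proof (intro conjI ballI allI impI)
    fix c d assume "c \<in> C" "d \<in> C"
    then obtain s t where "c = scale s x0" "d = scale t x0" "0 \<le> s" "0 \<le> t"
      by (auto simp: C_def)
    then show "m (c + d) \<le> m c + m d"
      using qC[of "s + t"] by (simp add: m_def qC scale_left_distrib distrib_right)
  next
    fix t :: real and c assume "0 < t" "c \<in> C"
    then show "m (scale t c) \<le> t * m c"
      by (simp add: m_def sublinear_scale[OF assms])
  qed
  moreover have "m 0 \<le> 0"
    by (simp add: m_def sublinear_0[OF assms])
  moreover have "\<exists>b. \<forall>c\<in>C. b \<le> q (x + c) + m c" for x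
  proof (intro exI ballI)
    fix c
    show "- q (- x) \<le> q (x + c) + m c"
      using sublinear_add[OF assms, of "x + c" "- x"] by (simp add: m_def)
  qed
  ultimately show thesis
    using sublinear_inf_convolution[OF assms C, of m] that[of "\<lambda>x. INF c\<in>C. q (x + c) + m c"] x0
    by (simp add: m_def)
qed

definition real_linear :: "('a \<Rightarrow> real) \<Rightarrow> bool"
  where "real_linear g \<longleftrightarrow> (\<forall>x y. g (x + y) = g x + g y) \<and> (\<forall>t x. g (scale t x) = t * g x)"

lemma real_linear_simps:
  assumes "real_linear g"
  shows "g (x + y) = g x + g y" "g (scale t x) = t * g x" "g (- x) = - g x" "g (x - y) = g x - g y" "g 0 = 0"
proof -
  show 1: "g (x + y) = g x + g y" for x y
    using assms by (simp add: real_linear_def)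
  show "g (scale t x) = t * g x"
    using assms by (simp add: real_linear_def)
  show 0: "g 0 = 0"
    using 1[of 0 0] by simp
  show 2: "g (- x) = - g x" for x
    using 1[of x "- x"] 0 by simp
  show "g (x - y) = g x - g y"
    using 1[of x "- y"] 2[of y] by simp
qed

text \<open>
  If \<open>q\<close> is minimal, the ray infimum in any direction \<open>y\<close> cannot lower it, which means
  \<open>q x + q y \<le> q (x + y)\<close>; together with subadditivity this is additivity.
\<close>

lemma minimal_sublinear_is_linear:
  assumes q: "sublinear q" and min: "\<And>r. \<lbrakk>sublinear r; \<And>x. r x \<le> q x\<rbrakk> \<Longrightarrow> r = q"
  shows "real_linear q"
proof -
  have ge: "q x + q y \<le> q (x + y)" for x y
  proof -
    obtain r where r: "sublinear r" "\<And>x. r x \<le> q x" "\<And>x. r x \<le> q (x + y) - q y"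
      using sublinear_ray_infimum[OF q, where ?x0.0 = y] by blast
    have "r = q"
      using min r(1,2) by blast
    with r(3)[of x] show ?thesis
      by simp
  qed
  have add: "q (x + y) = q x + q y" for x y
    using ge sublinear_add[OF q] by (intro antisym)
  have neg: "q (- x) = - q x" for x
    using add[of x "- x"] sublinear_0[OF q] by simp
  have "q (scale t x) = t * q x" for t x
  proof (cases t "0 :: real" rule: linorder_cases)
    case less
    then show ?thesis
      using sublinear_scale[OF q, of "- t" x] neg[of "scale t x"] by simp
  qed (use sublinear_scale[OF q] sublinear_0[OF q] in auto)
  with add show ?thesis
    by (simp add: real_linear_def)
qed

text \<open>
  The pointwise infimum over a chain is finite because \<open>- p (- x) \<le> q x\<close> for every sublinear
  \<open>q \<le> p\<close>, and subadditive because any two members of a chain have a common lower one.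
\<close>

lemma chain_infimum_sublinear:
  assumes p: "sublinear p" and "C \<noteq> {}" and C: "\<And>q. q \<in> C \<Longrightarrow> sublinear q \<and> q \<le> p"
    and chain: "\<And>q r. \<lbrakk>q \<in> C; r \<in> C\<rbrakk> \<Longrightarrow> q \<le> r \<or> r \<le> q"
  shows "sublinear (\<lambda>x. INF q\<in>C. q x)" and "\<And>q. q \<in> C \<Longrightarrow> (\<lambda>x. INF q\<in>C. q x) \<le> q"
proof -
  have "- p (- x) \<le> q x" if "q \<in> C" for q x
    using C[OF that] sublinear_minus[of q x] by (force simp: le_fun_def dest: spec[of _ "- x"])
  then have bb: "bdd_below ((\<lambda>q. q x) ` C)" for x
    by (auto simp: bdd_below_def)
  have le: "(INF q\<in>C. q x) \<le> q x" if "q \<in> C" for q x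
    by (rule cINF_lower[OF bb that])
  then show "\<And>q. q \<in> C \<Longrightarrow> (\<lambda>x. INF q\<in>C. q x) \<le> q"
    by (simp add: le_fun_def)
  have "(INF q\<in>C. q (x + y)) \<le> (INF q\<in>C. q x) + (INF q\<in>C. q y)" for x y
  proof -
    have "(INF q\<in>C. q (x + y)) \<le> q x + r y" if "q \<in> C" "r \<in> C" for q r
    proof -
      have "\<exists>s\<in>C. s x \<le> q x \<and> s y \<le> r y"
        using chain[OF that] that by (auto simp: le_fun_def)
      then obtain s where s: "s \<in> C" "s x \<le> q x" "s y \<le> r y"
        by blast
      then show ?thesis
        using le[of s "x + y"] sublinear_add[of s x y] C[of s] by force
    qed
    then have "(INF q\<in>C. q (x + y)) - r y \<le> (INF q\<in>C. q x)" if "r \<in> C" for r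
      using that assms(2) by (intro cINF_greatest) (auto simp: algebra_simps)
    then have "(INF q\<in>C. q (x + y)) - (INF q\<in>C. q x) \<le> (INF q\<in>C. q y)"
      using assms(2) by (intro cINF_greatest) (auto simp: algebra_simps)
    then show ?thesis
      by simp
  qed
  moreover have "(INF q\<in>C. q (scale t x)) \<le> t * (INF q\<in>C. q x)" if "t > 0" for t x
  proof -
    have "(INF q\<in>C. q (scale t x)) / t \<le> q x" if "q \<in> C" for q
      using le[OF that, of "scale t x"] C[OF that] sublinear_scale[of q t x] \<open>t > 0\<close>
      by (simp add: field_simps)
    then have "(INF q\<in>C. q (scale t x)) / t \<le> (INF q\<in>C. q x)"
      using assms(2) by (intro cINF_greatest)
    then show ?thesis
      using \<open>t > 0\<close> by (simp add: field_simps)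
  qed
  ultimately show "sublinear (\<lambda>x. INF q\<in>C. q x)"
    by (simp add: sublinear_on_def)
qed

text \<open>
  Zorn's lemma, for the reversed pointwise order on the sublinear functionals below \<open>p\<close>.
\<close>

lemma ex_linear_below_sublinear:
  assumes p: "sublinear p"
  shows "\<exists>g. real_linear g \<and> (\<forall>x. g x \<le> p x)"
proof -
  define S where "S = {q. sublinear q \<and> q \<le> p}"
  \<comment> \<open>upper bounds with respect to \<open>P\<close> are pointwise lower bounds\<close>
  define P where "P = (\<lambda>q r :: 'a \<Rightarrow> real. r \<le> q)"
  have "\<exists>m\<in>S. \<forall>a\<in>S. P m a \<longrightarrow> a = m"
  proof (rule predicate_Zorn)
    show "partial_order_on S (relation_of P S)"
      by (rule partial_order_on_relation_ofI) (auto simp: P_def)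
    show "\<exists>u\<in>S. \<forall>a\<in>C. P a u" if C: "C \<in> Chains (relation_of P S)" for C
    proof (cases "C = {}")
      case True
      then show ?thesis
        using p by (auto simp: S_def)
    next
      case False
      have CS: "C \<subseteq> S"
        using C by (auto simp: Chains_def relation_of_def)
      have chain: "q \<le> r \<or> r \<le> q" if "q \<in> C" "r \<in> C" for q r
        using C that by (auto simp: Chains_def relation_of_def P_def)
      note inf = chain_infimum_sublinear[OF p False _ chain]
      have *: "sublinear (\<lambda>x. INF q\<in>C. q x)" "\<And>q. q \<in> C \<Longrightarrow> (\<lambda>x. INF q\<in>C. q x) \<le> q"
        using CS by (intro inf; auto simp: S_def)+
      moreover obtain q where "q \<in> C"
        using False by blast
      ultimately have "(\<lambda>x. INF q\<in>C. q x) \<in> S"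
        using CS by (force simp: S_def intro: order_trans)
      then show ?thesis
        using *(2) by (auto simp: P_def)
    qed
  qed
  then obtain q where q: "sublinear q" "q \<le> p" and min: "\<And>r. \<lbrakk>r \<in> S; r \<le> q\<rbrakk> \<Longrightarrow> r = q"
    by (auto simp: S_def P_def)
  have "real_linear q"
  proof (rule minimal_sublinear_is_linear[OF q(1)])
    fix r assume "sublinear r" "\<And>x. r x \<le> q x"
    with q(2) show "r = q"
      by (intro min) (auto simp: S_def le_fun_def intro: order_trans)
  qed
  with q(2) show ?thesis
    by (auto simp: le_fun_def)
qed

lemma hahn_banach_touching:
  assumes "sublinear p"
  shows "\<exists>g. real_linear g \<and> (\<forall>x. g x \<le> p x) \<and> g x0 = p x0"
proof -
  obtain r where r: "sublinear r" "\<And>x. r x \<le> p x" "\<And>x. r x \<le> p (x + x0) - p x0"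
    using sublinear_ray_infimum[OF assms, where ?x0.0 = x0] by blast
  obtain g where g: "real_linear g" "\<And>x. g x \<le> r x"
    using ex_linear_below_sublinear[OF r(1)] by blast
  have "g (- x0) \<le> - p x0"
    using g(2)[of "- x0"] r(3)[of "- x0"] sublinear_0[OF assms] by simp
  then have "g x0 = p x0"
    using g(2)[of x0] r(2)[of x0] real_linear_simps(3)[OF g(1), of x0] by simp
  with g r show ?thesis
    by (meson order_trans)
qed

text \<open>
  Taking \<open>h = g - f\<close>, the claim is that some linear \<open>g\<close> lies below both \<open>p\<close> and \<open>f + p\<close>. A linear
  functional lies below two sublinear ones exactly if it lies below their infimal convolution, and the
  domination hypothesis is what makes this convolution finite.
\<close>

lemma linear_difference_of_dominated:
  assumes p: "sublinear p" and f: "real_linear f" and fp: "\<And>x. f x \<le> p x + p (- x)"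
  shows "\<exists>g h. real_linear g \<and> real_linear h \<and> (\<forall>x. g x \<le> p x \<and> h x \<le> p x \<and> f x = g x - h x)"
proof -
  define m where "m = (\<lambda>c. f (- c) + p (- c))"
  define r where "r = (\<lambda>x. INF c. p (x + c) + m c)"
  have C: "convex_cone UNIV"
    by (simp add: convex_cone_def)
  have m: "sublinear m"
    unfolding sublinear_on_def m_def
  proof (intro conjI ballI allI impI)
    fix x y
    show "f (- (x + y)) + p (- (x + y)) \<le> f (- x) + p (- x) + (f (- y) + p (- y))"
      using sublinear_add[OF p, of "- x" "- y"] real_linear_simps[OF f] by simp
  next
    fix t :: real and x assume "0 < t"
    then show "f (- scale t x) + p (- scale t x) \<le> t * (f (- x) + p (- x))"
      using sublinear_scale[OF p, of t "- x"] real_linear_simps[OF f]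
      by (simp add: algebra_simps)
  qed
  have m0: "m 0 \<le> 0"
    using sublinear_0[OF p] real_linear_simps[OF f] by (simp add: m_def)
  have bdd: "\<exists>b. \<forall>c\<in>UNIV. b \<le> p (x + c) + m c" for x
  proof (intro exI ballI)
    fix c
    have "p c \<le> p (x + c) + p (- x)"
      using sublinear_add[OF p, of "x + c" "- x"] by simp
    then show "- p (- x) \<le> p (x + c) + m c"
      using fp[of c] real_linear_simps(3)[OF f, of c] by (simp add: m_def)
  qed
  have r: "sublinear r" "\<And>x c. r x \<le> p (x + c) + m c" "\<And>x. r x \<le> p x"
    using sublinear_inf_convolution[OF p C m m0 bdd] by (simp_all add: r_def)
  obtain g where g: "real_linear g" "\<And>x. g x \<le> r x"
    using ex_linear_below_sublinear[OF r(1)] by blast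
  have 1: "g x \<le> p x" for x
    using g(2)[of x] r(3)[of x] by linarith
  have 2: "g x - f x \<le> p x" for x
    using g(2)[of x] r(2)[of x "- x"] real_linear_simps[OF f] sublinear_0[OF p] by (simp add: m_def)
  have 3: "real_linear (\<lambda>x. g x - f x)"
    using f g(1) by (simp add: real_linear_def algebra_simps)
  show ?thesis
    by (intro exI[of _ g] exI[of _ "\<lambda>x. g x - f x"]) (simp add: g(1) 1 2 3)
qed

end

section \<open>Matrices over a star vector space as functions of two indices\<close>

sublocale star_vector_space \<subseteq> vs: Vector_Spaces.vector_space "vscale V"
  by (rule vector_space)

context star_vector_space
begin

text \<open>
  Matrices of a fixed size form a vector space only on a carrier set. The functional analysis is
  therefore done on the full type of functions \<open>nat \<times> nat \<Rightarrow> 'v\<close>, which is an abelian group, and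
  \<open>M\<^sub>n(V)\<close> is reached through the upper left block: the norm of a function is the norm of its block,
  a seminorm which ignores the entries outside.
\<close>

definition fscale :: "complex \<Rightarrow> (nat \<times> nat \<Rightarrow> 'v) \<Rightarrow> nat \<times> nat \<Rightarrow> 'v"
  where "fscale c x = (\<lambda>p. vscale V c (x p))"

definition fstar :: "(nat \<times> nat \<Rightarrow> 'v) \<Rightarrow> nat \<times> nat \<Rightarrow> 'v"
  where "fstar x = (\<lambda>(i, j). vstar V (x (j, i)))"

definition herm :: "(nat \<times> nat \<Rightarrow> 'v) \<Rightarrow> nat \<times> nat \<Rightarrow> 'v"
  where "herm x = fscale (1 / 2) (x + fstar x)"

abbreviation block :: "nat \<Rightarrow> (nat \<times> nat \<Rightarrow> 'v) \<Rightarrow> 'v mat"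
  where "block n x \<equiv> Matrix.mat n n x"

sublocale fs: Vector_Spaces.vector_space fscale
  by unfold_locales
    (auto simp: fscale_def vs.scale_right_distrib vs.scale_left_distrib fun_eq_iff)

sublocale fr: real_linear_space "\<lambda>r. fscale (complex_of_real r)"
  by unfold_locales
    (auto simp: fs.scale_right_distrib fs.scale_left_distrib)

lemma star_0 [simp]: "vstar V 0 = 0"
  using star_add[of 0 0] by simp

lemma star_minus: "vstar V (- v) = - vstar V v"
  using star_add[of v "- v"] by (simp add: eq_neg_iff_add_eq_0 add.commute)

lemma fstar_fstar [simp]: "fstar (fstar x) = x"
  by (auto simp: fstar_def star_star)

lemma fstar_add: "fstar (x + y) = fstar x + fstar y"
  by (auto simp: fstar_def star_add)

lemma fstar_minus: "fstar (- x) = - fstar x"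
  by (auto simp: fstar_def star_minus fun_eq_iff)

lemma fstar_fscale: "fstar (fscale c x) = fscale (cnj c) (fstar x)"
  by (auto simp: fstar_def fscale_def star_scale)

lemma herm_add: "herm (x + y) = herm x + herm y"
  by (simp add: herm_def fstar_add fs.scale_right_distrib ac_simps)

lemma herm_minus: "herm (- x) = - herm x"
  by (simp add: herm_def fstar_minus flip: fs.scale_minus_right)

lemma herm_diff: "herm (x - y) = herm x - herm y"
  using herm_add[of x "- y"] herm_minus[of y] by simp

lemma herm_fscale: "herm (fscale (complex_of_real r) x) = fscale (complex_of_real r) (herm x)"
  by (simp add: herm_def fstar_fscale fs.scale_right_distrib mult.commute)

lemma fstar_herm: "fstar (herm x) = herm x"
  by (simp add: herm_def fstar_fscale fstar_add add.commute)

lemma herm_diff_fstar: "herm (x - fstar x) = 0"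
  using fstar_add[of x "- fstar x"] by (simp add: herm_def fstar_minus)

lemma herm_add_fstar_ii: "herm (fscale \<i> (x + fstar x)) = 0"
  by (simp add: herm_def fstar_fscale fstar_add fs.scale_right_distrib)

lemma block_add: "block n (x + y) = block n x + block n y"
  by (rule eq_matI) auto

lemma block_diff: "block n (x - y) = block n x - block n y"
  by (rule eq_matI) auto

lemma block_uminus: "block n (- x) = - block n x"
  by (rule eq_matI) auto

lemma block_fscale: "block n (fscale c x) = map_mat (vscale V c) (block n x)"
  by (rule eq_matI) (auto simp: fscale_def)

lemma block_fstar: "block n (fstar x) = mat_star (vstar V) (block n x)"
  by (rule eq_matI) (auto simp: fstar_def mat_star_def)

lemma block_index: "A \<in> carrier_mat n n \<Longrightarrow> block n (($$) A) = A"
  by (rule eq_matI) auto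

lemma block_herm_sa: "block n (herm x) \<in> mat_sa (vstar V) n"
  unfolding mat_sa_def by (simp flip: block_fstar add: fstar_herm)

lemma block_herm_cong: "block n x = block n y \<Longrightarrow> block n (herm x) = block n (herm y)"
  by (simp add: herm_def block_fscale block_add block_fstar)

lemma block_herm_of_sa:
  assumes "block n x \<in> mat_sa (vstar V) n"
  shows "block n (herm x) = block n x"
proof -
  have "block n (fstar x) = block n x"
    using assms by (simp add: mat_sa_def block_fstar)
  then have "block n (herm x) = map_mat (vscale V (1 / 2)) (block n x + block n x)"
    by (simp add: herm_def block_fscale block_add)
  also have "\<dots> = block n x"
    by (rule eq_matI) (auto simp flip: vs.scale_left_distrib simp: vs.scale_right_distrib)
  finally show ?thesis .
qed

end

context cstar_ordered_operator_space
begin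

section \<open>The norm of the elements above a given one\<close>

lemma norm_zero: "0 < n \<Longrightarrow> mnorm V n (0\<^sub>m n n) = 0"
  by (simp add: norm_eq_0)

lemma norm_uminus:
  assumes "0 < n" "A \<in> carrier_mat n n"
  shows "mnorm V n (- A) = mnorm V n A"
proof -
  have "- A = map_mat (vscale V (- 1)) A"
    by (rule eq_matI) auto
  then show ?thesis
    using norm_scale[OF assms, of "- 1"] by simp
qed

lemma norm_nonneg:
  assumes "0 < n" "A \<in> carrier_mat n n"
  shows "0 \<le> mnorm V n A"
proof -
  have "A + - A = 0\<^sub>m n n"
    using assms(2) by (intro eq_matI) auto
  then show ?thesis
    using norm_triangle[OF assms, of "- A"] norm_uminus[OF assms] norm_zero[OF assms(1)] assms(2) by simp
qed

lemma zero_in_cone: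
  assumes "0 < n"
  shows "0\<^sub>m n n \<in> mcone V n"
proof -
  have "0\<^sub>m 1 1 \<in> mcone V 1"
    using proper by blast
  from cone_compress[OF _ assms, of 1 "0\<^sub>m 1 n", OF _ _ this]
  have "scalar_mult_right V (scalar_mult_left V (mat_star cnj (0\<^sub>m 1 n)) (0\<^sub>m 1 1)) (0\<^sub>m 1 n) \<in> mcone V n"
    by simp
  also have "scalar_mult_right V (scalar_mult_left V (mat_star cnj (0\<^sub>m 1 n)) (0\<^sub>m 1 1)) (0\<^sub>m 1 n) = 0\<^sub>m n n"
    by (rule eq_matI) (auto simp: scalar_mult_right_def scalar_mult_left_def mat_star_def)
  finally show ?thesis .
qed

lemma cone_carrier: "0 < n \<Longrightarrow> A \<in> mcone V n \<Longrightarrow> A \<in> carrier_mat n n"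
  using cone_sa by (auto simp: mat_sa_def)

definition cone_fun :: "nat \<Rightarrow> (nat \<times> nat \<Rightarrow> 'v) set"
  where "cone_fun n = {k. block n k \<in> mcone V n}"

text \<open>
  Composing the norm with the self-adjoint part makes every real functional dominated by it vanish on
  skew-adjoint elements. Functionals on \<open>M\<^sub>n(V)\<^sub>s\<^sub>a\<close> thus become functionals on the whole space.
\<close>

definition norm_herm :: "nat \<Rightarrow> (nat \<times> nat \<Rightarrow> 'v) \<Rightarrow> real"
  where "norm_herm n x = mnorm V n (block n (herm x))"

text \<open>
  For self-adjoint \<open>x\<close> this is \<open>inf {\<parallel>y\<parallel> | x \<le> y}\<close>. Real functionals dominated by it are exactly
  the positive ones of norm at most one: domination forces them to be nonpositive on \<open>- M\<^sub>n(V)\<^sup>+\<close>.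
\<close>

definition upper_norm :: "nat \<Rightarrow> (nat \<times> nat \<Rightarrow> 'v) \<Rightarrow> real"
  where "upper_norm n x = (INF k\<in>cone_fun n. norm_herm n (x + k))"

lemma norm_herm_sublinear:
  assumes "0 < n"
  shows "fr.sublinear (norm_herm n)"
  unfolding fr.sublinear_on_def norm_herm_def
  using assms by (auto simp: herm_add block_add norm_triangle herm_fscale block_fscale norm_scale)

lemma cone_fun_convex_cone:
  assumes "0 < n"
  shows "fr.convex_cone (cone_fun n)"
proof -
  have "block n 0 = 0\<^sub>m n n"
    by (rule eq_matI) auto
  then show ?thesis
    using assms zero_in_cone[OF assms] cone_add[OF assms] cone_scale[OF assms]
    by (auto simp: fr.convex_cone_def cone_fun_def block_add block_fscale)
qed

lemma norm_herm_nonneg: "0 < n \<Longrightarrow> 0 \<le> norm_herm n x"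
  by (simp add: norm_herm_def norm_nonneg)

lemma norm_herm_le:
  assumes "0 < n"
  shows "norm_herm n x \<le> mnorm V n (block n x)"
proof -
  have "norm_herm n x = mnorm V n (block n (x + fstar x)) / 2"
    using norm_scale[OF assms, of "block n (x + fstar x)" "1 / 2"]
    by (simp add: norm_herm_def herm_def block_fscale)
  also have "mnorm V n (block n (x + fstar x)) \<le> mnorm V n (block n x) + mnorm V n (block n x)"
    using norm_triangle[OF assms, of "block n x" "block n (fstar x)"] star_isometry[OF assms, of "block n x"]
    by (simp add: block_add block_fstar mat_star_def)
  finally show ?thesis
    by simp
qed

lemma upper_norm_props:
  assumes "0 < n"
  shows upper_norm_sublinear: "fr.sublinear (upper_norm n)"
    and upper_norm_le: "k \<in> cone_fun n \<Longrightarrow> upper_norm n x \<le> norm_herm n (x + k)"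
    and upper_norm_le_norm_herm: "upper_norm n x \<le> norm_herm n x"
proof -
  have *: "\<exists>b. \<forall>c\<in>cone_fun n. b \<le> norm_herm n (x + c) + 0" for x
    using norm_herm_nonneg[OF assms] by (intro exI[of _ 0]) simp
  have m: "fr.sublinear_on (cone_fun n) (\<lambda>_. 0)"
    by (simp add: fr.sublinear_on_def)
  note r = fr.sublinear_inf_convolution[OF norm_herm_sublinear[OF assms] cone_fun_convex_cone[OF assms] m order_refl *,
      unfolded add_0_right, folded upper_norm_def]
  show "fr.sublinear (upper_norm n)"
    using r(1) .
  show "k \<in> cone_fun n \<Longrightarrow> upper_norm n x \<le> norm_herm n (x + k)"
    using r(2) .
  show "upper_norm n x \<le> norm_herm n x"
    using r(3) .
qed

lemma upper_norm_approx:
  assumes "0 < n" "e > 0"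
  obtains k where "k \<in> cone_fun n" "norm_herm n (x + k) < upper_norm n x + e"
proof -
  have ne: "cone_fun n \<noteq> {}"
    using cone_fun_convex_cone[OF assms(1)] by (auto simp: fr.convex_cone_def)
  have "(INF k\<in>cone_fun n. norm_herm n (x + k)) < upper_norm n x + e"
    using assms(2) by (simp add: upper_norm_def)
  then show thesis
    using that norm_herm_nonneg[OF assms(1)]
    by (subst (asm) cINF_less_iff[OF ne]) (auto simp: bdd_below_def)
qed

lemma upper_norm_uminus_cone:
  assumes "0 < n" "k \<in> cone_fun n"
  shows "upper_norm n (- k) \<le> 0"
proof -
  have "norm_herm n (- k + k) = 0"
    using fr.sublinear_0[OF norm_herm_sublinear[OF assms(1)]] by simp
  then show ?thesis
    using upper_norm_le[OF assms, of "- k"] by simp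
qed

text \<open>
  If \<open>x \<le> y\<close> and \<open>- x \<le> z\<close>, then \<open>- z \<le> x \<le> y\<close>, so the order condition on the norm bounds
  \<open>\<parallel>x\<parallel>\<close> by \<open>max \<parallel>z\<parallel> \<parallel>y\<parallel>\<close>.
\<close>

lemma norm_herm_le_upper_norm:
  assumes "0 < n"
  shows "norm_herm n x \<le> max (upper_norm n x) (upper_norm n (- x))"
proof (rule field_le_epsilon)
  fix e :: real assume "0 < e"
  obtain k where k: "k \<in> cone_fun n" "norm_herm n (x + k) < upper_norm n x + e"
    by (rule upper_norm_approx[OF assms \<open>0 < e\<close>])
  obtain l where l: "l \<in> cone_fun n" "norm_herm n (- x + l) < upper_norm n (- x) + e"
    by (rule upper_norm_approx[OF assms \<open>0 < e\<close>])
  have herm: "block n (herm c) = block n c" if "c \<in> cone_fun n" for c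
    using that cone_sa[OF assms] by (intro block_herm_of_sa) (auto simp: cone_fun_def)
  let ?F = "block n (herm (x - l))" and ?G = "block n (herm x)" and ?H = "block n (herm (x + k))"
  have "?G - ?F = block n (herm l)"
    by (simp add: herm_diff flip: block_diff)
  then have 1: "?G - ?F \<in> mcone V n"
    using l(1) herm[OF l(1)] by (simp add: cone_fun_def)
  have "?H - ?G = block n (herm k)"
    by (simp add: herm_add flip: block_diff)
  then have 2: "?H - ?G \<in> mcone V n"
    using k(1) herm[OF k(1)] by (simp add: cone_fun_def)
  have "?F = - block n (herm (- x + l))"
    by (simp flip: block_uminus herm_minus)
  then have "mnorm V n ?F = norm_herm n (- x + l)"
    by (simp add: norm_herm_def norm_uminus[OF assms])
  moreover have "mnorm V n ?G \<le> max (mnorm V n ?F) (mnorm V n ?H)"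
    by (intro norm_between[OF assms] block_herm_sa 1 2)
  ultimately show "norm_herm n x \<le> max (upper_norm n x) (upper_norm n (- x)) + e"
    using k(2) l(2) by (simp add: norm_herm_def)
qed

text \<open>
  \<open>upper_norm n (- A)\<close> is the distance of \<open>A\<close> from the cone, which is norm closed.
\<close>

lemma upper_norm_pos_outside_cone:
  assumes "0 < n" "A \<in> mat_sa (vstar V) n" "A \<notin> mcone V n"
  shows "0 < upper_norm n (- ($$) A)"
proof (rule ccontr)
  assume neg: "\<not> ?thesis"
  have A: "A \<in> carrier_mat n n"
    using assms(2) by (simp add: mat_sa_def)
  have "\<exists>k\<in>cone_fun n. norm_herm n (- ($$) A + k) < inverse (real (Suc m))" for m
    using upper_norm_approx[OF assms(1), of "inverse (real (Suc m))" "- ($$) A"] neg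
    by (smt (verit, ccfv_threshold) inverse_positive_iff_positive of_nat_0_less_iff zero_less_Suc)
  then obtain k where k: "\<And>m. k m \<in> cone_fun n" "\<And>m. norm_herm n (- ($$) A + k m) < inverse (real (Suc m))"
    by metis
  have "norm_herm n (- ($$) A + k m) = mnorm V n (block n (k m) - A)" for m
  proof -
    have km: "block n (k m) \<in> mat_sa (vstar V) n"
      using k(1)[of m] cone_sa[OF assms(1)] by (auto simp: cone_fun_def)
    have "block n (herm (($$) A)) = A"
      using block_herm_of_sa[of n "($$) A"] assms(2) block_index[OF A] by simp
    then show ?thesis
      using block_herm_of_sa[OF km] by (simp add: norm_herm_def herm_diff block_diff)
  qed
  with k(2) have lt: "mnorm V n (block n (k m) - A) < inverse (real (Suc m))" for m
    by simp
  have "(\<lambda>m. mnorm V n (block n (k m) - A)) \<longlonglongrightarrow> 0"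
  proof (rule tendsto_sandwich[OF _ _ tendsto_const LIMSEQ_inverse_real_of_nat])
    show "\<forall>\<^sub>F m in sequentially. 0 \<le> mnorm V n (block n (k m) - A)"
      using A assms(1) by (intro always_eventually allI norm_nonneg) (auto intro: minus_carrier_mat)
    show "\<forall>\<^sub>F m in sequentially. mnorm V n (block n (k m) - A) \<le> inverse (real (Suc m))"
      using lt by (intro always_eventually allI less_imp_le)
  qed
  then have "A \<in> mcone V n"
    using k(1) by (intro cone_closed[OF assms(1) _ A, of "\<lambda>m. block n (k m)"]) (auto simp: cone_fun_def)
  with assms(3) show False
    by simp
qed

end

section \<open>Functionals on matrices and their matrices of functionals\<close>

lemma mat_star_carrier [simp]: "mat_star s A \<in> carrier_mat n m \<longleftrightarrow> A \<in> carrier_mat m n"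
  by (simp add: mat_star_def)

lemma mat_star_index [simp]:
  "i < dim_col A \<Longrightarrow> j < dim_row A \<Longrightarrow> mat_star s A $$ (i, j) = s (A $$ (j, i))"
  by (simp add: mat_star_def)

lemma mat_star_dim [simp]: "dim_row (mat_star s A) = dim_col A" "dim_col (mat_star s A) = dim_row A"
  by (simp_all add: mat_star_def)

lemma mat11_carrier [simp]: "mat11 x \<in> carrier_mat (Suc 0) (Suc 0)"
  by (simp add: mat11_def)

lemma mat11_index [simp]: "mat11 x $$ (0, 0) = x"
  by (simp add: mat11_def)

text \<open>
  \<open>single i j v\<close> is the matrix unit at \<open>(i, j)\<close> with entry \<open>v\<close>; over the scalars, with \<open>v = 1\<close>,
  its blocks are the usual matrix units.
\<close>

definition single :: "nat \<Rightarrow> nat \<Rightarrow> 'v::zero \<Rightarrow> nat \<times> nat \<Rightarrow> 'v"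
  where "single i j v = (\<lambda>p. if p = (i, j) then v else 0)"

context star_vector_space
begin

lemma single_add: "single i j (v + w :: 'v) = single i j v + single i j w"
  by (rule ext) (simp add: single_def)

lemma single_scale: "single i j (vscale V c v) = fscale c (single i j v)"
  by (rule ext) (simp add: single_def fscale_def)

lemma fstar_single: "fstar (single i j v) = single j i (vstar V v)"
  by (rule ext) (simp add: single_def fstar_def split: prod.split)

lemma scalar_mult_matrix_units:
  fixes A :: "'v mat"
  assumes "A \<in> carrier_mat n n" "p < n" "q < n" "i < n" "j < n"
  shows "scalar_mult_right V (scalar_mult_left V (Matrix.mat n n (single p i 1)) A) (Matrix.mat n n (single j q 1))
    = block n (single p q (A $$ (i, j)))"
proof (rule eq_matI)
  fix a b assume "a < dim_row (block n (single p q (A $$ (i, j))))" "b < dim_col (block n (single p q (A $$ (i, j))))"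
  then have ab: "a < n" "b < n"
    by auto
  have 1: "(\<Sum>k<n. vscale V (single p i 1 (a, k)) (A $$ (k, l))) = (if a = p then A $$ (i, l) else 0)" for l
  proof -
    have "(\<Sum>k<n. vscale V (single p i 1 (a, k)) (A $$ (k, l))) = (\<Sum>k<n. if k = i then (if a = p then A $$ (i, l) else 0) else 0)"
      by (rule sum.cong) (auto simp: single_def)
    then show ?thesis
      using assms by simp
  qed
  have "(\<Sum>l<n. vscale V (single j q 1 (l, b)) (if a = p then A $$ (i, l) else 0))
      = (\<Sum>l<n. if l = j then single p q (A $$ (i, j)) (a, b) else 0)"
    by (rule sum.cong) (auto simp: single_def)
  then have 2: "(\<Sum>l<n. vscale V (single j q 1 (l, b)) (if a = p then A $$ (i, l) else 0)) = single p q (A $$ (i, j)) (a, b)"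
    using assms by simp
  show "scalar_mult_right V (scalar_mult_left V (Matrix.mat n n (single p i 1)) A) (Matrix.mat n n (single j q 1)) $$ (a, b)
      = block n (single p q (A $$ (i, j))) $$ (a, b)"
    using ab assms(1) 1 2 by (simp add: scalar_mult_right_def scalar_mult_left_def)
qed (use assms in \<open>auto simp: scalar_mult_right_def scalar_mult_left_def\<close>)

lemma dual_space_iff:
  "\<phi> \<in> dual_space V \<longleftrightarrow> (\<forall>v w. \<phi> (v + w) = \<phi> v + \<phi> w) \<and> (\<forall>c v. \<phi> (vscale V c v) = c * \<phi> v)
    \<and> (\<exists>C. \<forall>v. cmod (\<phi> v) \<le> C * mnorm V 1 (mat11 v))"
proof -
  have "Vector_Spaces.vector_space ((*) :: complex \<Rightarrow> _)"
    by unfold_locales (auto simp: algebra_simps)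
  then show ?thesis
    unfolding dual_space_def Vector_Spaces.linear_iff mem_Collect_eq
    using vs.vector_space_axioms by argo
qed

lemma dual_space_add: "\<phi> \<in> dual_space V \<Longrightarrow> \<phi> (v + w) = \<phi> v + \<phi> w"
  and dual_space_scale: "\<phi> \<in> dual_space V \<Longrightarrow> \<phi> (vscale V c v) = c * \<phi> v"
  by (simp_all add: dual_space_iff)

lemma dual_space_0: "\<phi> \<in> dual_space V \<Longrightarrow> \<phi> 0 = 0"
  using dual_space_add[of \<phi> 0 0] by simp

lemma mat_dual_carrier: "f \<in> mat_dual V n \<Longrightarrow> f \<in> carrier_mat n n"
  by (simp add: mat_dual_def)

lemma mat_dual_entry: "f \<in> mat_dual V n \<Longrightarrow> i < n \<Longrightarrow> j < n \<Longrightarrow> f $$ (i, j) \<in> dual_space V"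
  by (simp add: mat_dual_def)

lemma pairing_add_right:
  assumes "f \<in> mat_dual V n" "A \<in> carrier_mat n n" "B \<in> carrier_mat n n"
  shows "mat_pairing n f (A + B) = mat_pairing n f A + mat_pairing n f B"
  using assms by (simp add: mat_pairing_def mat_dual_entry dual_space_add sum.distrib)

lemma pairing_scale_right:
  assumes "f \<in> mat_dual V n" "A \<in> carrier_mat n n"
  shows "mat_pairing n f (map_mat (vscale V c) A) = c * mat_pairing n f A"
  using assms by (simp add: mat_pairing_def mat_dual_entry dual_space_scale sum_distrib_left)

lemma pairing_zero_right: "f \<in> mat_dual V n \<Longrightarrow> mat_pairing n f (0\<^sub>m n n) = 0"
  by (simp add: mat_pairing_def mat_dual_entry dual_space_0)

end

lemma pairing_add_left:
  assumes "f \<in> carrier_mat n n" "g \<in> carrier_mat n n"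
  shows "mat_pairing n (f + g) A = mat_pairing n f A + mat_pairing n g A"
  using assms by (simp add: mat_pairing_def sum.distrib)

lemma pairing_scale_left:
  assumes "f \<in> carrier_mat n n"
  shows "mat_pairing n (map_mat (dual_scale c) f) A = c * mat_pairing n f A"
  using assms by (simp add: mat_pairing_def dual_scale_def sum_distrib_left)

context cstar_ordered_operator_space
begin

text \<open>
  \<open>v \<oplus> 0\<close> has the norm of \<open>v\<close> by the direct sum axiom; this identifies \<open>V\<close> isometrically with a corner of
  \<open>M\<^sub>n(V)\<close> and is the link between the norms at different levels.
\<close>

lemma corner_norm:
  assumes "0 < n"
  shows "mnorm V n (block n (single 0 0 v)) = mnorm V 1 (mat11 v)"
proof (cases "n = 1")
  case True
  moreover have "block 1 (single 0 0 v) = mat11 v"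
    by (rule eq_matI) (auto simp: mat11_def single_def)
  ultimately show ?thesis
    by simp
next
  case False
  then obtain m where n: "n = 1 + m" "0 < m"
    using assms by (metis nat_neq_iff less_one less_imp_add_positive)
  have "block (1 + m) (single 0 0 v) = four_block_mat (mat11 v) (0\<^sub>m 1 m) (0\<^sub>m m 1) (0\<^sub>m m m)"
    by (rule eq_matI) (auto simp: mat11_def single_def)
  then show ?thesis
    using norm_direct_sum[of 1 m "mat11 v" "0\<^sub>m m m"] norm_zero[OF n(2)] norm_nonneg[of 1 "mat11 v"] n
    by simp
qed

text \<open>
  Multiplication by scalar matrix units picks the entry \<open>(i, j)\<close> and moves it to \<open>(p, q)\<close>. The operator
  norms of these units enter only through the constant \<open>C\<close>. Taking the target or
  the source in the corner \<open>(0, 0)\<close> shows that entrywise boundedness and boundedness on \<open>M\<^sub>n(V)\<close> agree.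
\<close>

lemma entry_to_entry_bounded:
  assumes "0 < n" "i < n" "j < n" "p < n" "q < n"
  shows "\<exists>C\<ge>0. \<forall>A\<in>carrier_mat n n. mnorm V n (block n (single p q (A $$ (i, j)))) \<le> C * mnorm V n A"
proof -
  define a where "a = scalar_mat_norm (Matrix.mat n n (single p i 1))"
  define b where "b = scalar_mat_norm (Matrix.mat n n (single j q 1))"
  have "mnorm V n (block n (single p q (A $$ (i, j)))) \<le> (\<bar>a\<bar> * \<bar>b\<bar>) * mnorm V n A"
    if A: "A \<in> carrier_mat n n" for A
  proof -
    have "mnorm V n (block n (single p q (A $$ (i, j)))) \<le> a * mnorm V n A * b"
      using norm_scalar_mult[OF assms(1) _ _ A, of "Matrix.mat n n (single p i 1)" "Matrix.mat n n (single j q 1)"]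
        scalar_mult_matrix_units[OF A assms(4,5,2,3)] by (simp add: a_def b_def)
    also have "\<dots> \<le> \<bar>a * mnorm V n A * b\<bar>"
      by simp
    finally show ?thesis
      using norm_nonneg[OF assms(1) A] by (simp add: abs_mult mult_ac)
  qed
  then show ?thesis
    by (intro exI[of _ "\<bar>a\<bar> * \<bar>b\<bar>"]) auto
qed

lemma entry_bounded:
  assumes "0 < n" "i < n" "j < n"
  shows "\<exists>C\<ge>0. \<forall>A\<in>carrier_mat n n. mnorm V 1 (mat11 (A $$ (i, j))) \<le> C * mnorm V n A"
  using entry_to_entry_bounded[OF assms assms(1) assms(1)] unfolding corner_norm[OF assms(1)] .

lemma single_bounded:
  assumes "0 < n" "p < n" "q < n"
  shows "\<exists>C\<ge>0. \<forall>v. mnorm V n (block n (single p q v)) \<le> C * mnorm V 1 (mat11 v)"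
proof -
  obtain C where C: "0 \<le> C"
    "\<forall>A\<in>carrier_mat n n. mnorm V n (block n (single p q (A $$ (0, 0)))) \<le> C * mnorm V n A"
    using entry_to_entry_bounded[OF assms(1) assms(1) assms(1) assms(2,3)] by blast
  have "mnorm V n (block n (single p q v)) \<le> C * mnorm V 1 (mat11 v)" for v
    using C(2)[rule_format, of "block n (single 0 0 v)"] assms(1) corner_norm[OF assms(1), of v]
    by (simp add: single_def)
  with C(1) show ?thesis
    by blast
qed

lemma pairing_bounded:
  assumes "0 < n" "f \<in> mat_dual V n"
  shows "\<exists>C\<ge>0. \<forall>A\<in>carrier_mat n n. cmod (mat_pairing n f A) \<le> C * mnorm V n A"
proof -
  have "\<exists>c\<ge>0. \<forall>A\<in>carrier_mat n n. cmod ((f $$ (i, j)) (A $$ (i, j))) \<le> c * mnorm V n A" if ij: "i < n" "j < n" for i j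
  proof -
    obtain C where C: "0 \<le> C" "\<And>A. A \<in> carrier_mat n n \<Longrightarrow> mnorm V 1 (mat11 (A $$ (i, j))) \<le> C * mnorm V n A"
      using entry_bounded[OF assms(1) ij] by blast
    obtain D where D: "\<And>v. cmod ((f $$ (i, j)) v) \<le> D * mnorm V 1 (mat11 v)"
      using mat_dual_entry[OF assms(2) ij] by (auto simp: dual_space_iff)
    show ?thesis
    proof (intro exI[of _ "\<bar>D\<bar> * C"] conjI ballI)
      fix A :: "'v mat" assume A: "A \<in> carrier_mat n n"
      have "cmod ((f $$ (i, j)) (A $$ (i, j))) \<le> D * mnorm V 1 (mat11 (A $$ (i, j)))"
        by (rule D)
      also have "\<dots> \<le> \<bar>D\<bar> * (C * mnorm V n A)"
        using C(2)[OF A] norm_nonneg[of 1 "mat11 (A $$ (i, j))"] by (intro mult_mono) auto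
      finally show "cmod ((f $$ (i, j)) (A $$ (i, j))) \<le> (\<bar>D\<bar> * C) * mnorm V n A"
        by simp
    qed (use C in auto)
  qed
  then obtain c where c: "\<And>i j. i < n \<Longrightarrow> j < n \<Longrightarrow> 0 \<le> c i j"
    "\<And>i j A. i < n \<Longrightarrow> j < n \<Longrightarrow> A \<in> carrier_mat n n \<Longrightarrow> cmod ((f $$ (i, j)) (A $$ (i, j))) \<le> c i j * mnorm V n A"
    by metis
  show ?thesis
  proof (intro exI[of _ "\<Sum>i<n. \<Sum>j<n. c i j"] conjI ballI)
    show "0 \<le> (\<Sum>i<n. \<Sum>j<n. c i j)"
      using c(1) by (intro sum_nonneg) auto
    show "cmod (mat_pairing n f A) \<le> (\<Sum>i<n. \<Sum>j<n. c i j) * mnorm V n A" if "A \<in> carrier_mat n n" for A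
      unfolding mat_pairing_def sum_distrib_right
      using c(2)[OF _ _ that] by (intro sum_norm_le) auto
  qed
qed

text \<open>
  The supremum defining the dual norm is taken over a bounded set, so a bound on it bounds every member;
  without boundedness a supremum of reals says nothing.
\<close>

lemma dual_norm_le_1_iff:
  assumes "0 < n" "f \<in> mat_dual V n"
  shows "dual_norm V n f \<le> 1 \<longleftrightarrow> (\<forall>A\<in>carrier_mat n n. cmod (mat_pairing n f A) \<le> mnorm V n A)"
proof
  let ?S = "{cmod (mat_pairing n f A) |A. A \<in> carrier_mat n n \<and> mnorm V n A \<le> 1}"
  assume le: "dual_norm V n f \<le> 1"
  obtain C where C: "0 \<le> C" "\<And>A. A \<in> carrier_mat n n \<Longrightarrow> cmod (mat_pairing n f A) \<le> C * mnorm V n A"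
    using pairing_bounded[OF assms] by blast
  have bdd: "bdd_above ?S"
  proof (rule bdd_aboveI[of _ C])
    fix x assume "x \<in> ?S"
    then obtain A where A: "A \<in> carrier_mat n n" "mnorm V n A \<le> 1" "x = cmod (mat_pairing n f A)"
      by blast
    then show "x \<le> C"
      using C(2)[OF A(1)] mult_left_mono[OF A(2) C(1)] by simp
  qed
  show "\<forall>A\<in>carrier_mat n n. cmod (mat_pairing n f A) \<le> mnorm V n A"
  proof
    fix A :: "'v mat" assume A: "A \<in> carrier_mat n n"
    show "cmod (mat_pairing n f A) \<le> mnorm V n A"
    proof (cases "mnorm V n A = 0")
      case True
      then show ?thesis
        using C(2)[OF A] by simp
    next
      case False
      then have pos: "0 < mnorm V n A"
        using norm_nonneg[OF assms(1) A] by simp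
      define r where "r = inverse (mnorm V n A)"
      let ?B = "map_mat (vscale V (complex_of_real r)) A"
      have "mnorm V n ?B = 1"
        using pos unfolding norm_scale[OF assms(1) A] norm_of_real by (simp add: r_def)
      moreover have "?B \<in> carrier_mat n n"
        using A by simp
      ultimately have B: "cmod (mat_pairing n f ?B) \<in> ?S"
        by auto
      have "cmod (mat_pairing n f ?B) \<le> 1"
        by (rule order_trans[OF cSup_upper[OF B bdd] le[unfolded dual_norm_def]])
      then show ?thesis
        using pos unfolding pairing_scale_right[OF assms(2) A] norm_mult norm_of_real r_def
        by (simp add: field_simps)
    qed
  qed
next
  assume "\<forall>A\<in>carrier_mat n n. cmod (mat_pairing n f A) \<le> mnorm V n A"
  then have "x \<le> 1" if "x \<in> {cmod (mat_pairing n f A) |A. A \<in> carrier_mat n n \<and> mnorm V n A \<le> 1}" for x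
    using that by fastforce
  moreover have "0\<^sub>m n n \<in> carrier_mat n n \<and> mnorm V n (0\<^sub>m n n) \<le> 1"
    using norm_zero[OF assms(1)] by simp
  then have "{cmod (mat_pairing n f A) |A. A \<in> carrier_mat n n \<and> mnorm V n A \<le> 1} \<noteq> {}"
    by blast
  ultimately show "dual_norm V n f \<le> 1"
    unfolding dual_norm_def by (intro cSup_least)
qed

lemma Q_set_iff:
  assumes "0 < n"
  shows "f \<in> Q_set V n \<longleftrightarrow> f \<in> dual_cone V n \<and> (\<forall>A\<in>carrier_mat n n. cmod (mat_pairing n f A) \<le> mnorm V n A)"
  using dual_norm_le_1_iff[OF assms, of f] by (auto simp: Q_set_def dual_cone_def)

lemma Q_set_mat_dual: "f \<in> Q_set V n \<Longrightarrow> f \<in> mat_dual V n"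
  by (simp add: Q_set_def dual_cone_def)

text \<open>
  The inverse of the pairing: a complex functional on functions of two indices is turned into the matrix of
  its restrictions to the entries.
\<close>

definition functional_matrix :: "nat \<Rightarrow> ((nat \<times> nat \<Rightarrow> 'v) \<Rightarrow> complex) \<Rightarrow> ('v \<Rightarrow> complex) mat"
  where "functional_matrix n F = Matrix.mat n n (\<lambda>(i, j). \<lambda>v. F (single i j v))"

lemma pairing_functional_matrix:
  assumes add: "\<And>x y. F (x + y) = F x + F y" and block: "\<And>x. block n x = 0\<^sub>m n n \<Longrightarrow> F x = 0"
    and A: "A \<in> carrier_mat n n"
  shows "mat_pairing n (functional_matrix n F) A = F (($$) A)"
proof -
  have F0: "F 0 = 0"
    using add[of 0 0] by simp
  have F_sum: "F (\<Sum>i\<in>I. x i) = (\<Sum>i\<in>I. F (x i))" if "finite I" for x and I :: "nat set"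
    using that by (induction I) (simp_all only: sum.empty sum.insert F0 add not_False_eq_True)
  define y where "y = (\<Sum>i<n. \<Sum>j<n. single i j (A $$ (i, j)))"
  have "block n (($$) A - y) = 0\<^sub>m n n"
  proof (rule eq_matI)
    fix a b assume "a < dim_row (0\<^sub>m n n :: 'v mat)" "b < dim_col (0\<^sub>m n n :: 'v mat)"
    then have ab: "a < n" "b < n"
      by auto
    have sum_apply: "(\<Sum>i\<in>I. x i) p = (\<Sum>i\<in>I. x i p)" if "finite I" for x :: "nat \<Rightarrow> nat \<times> nat \<Rightarrow> 'v" and I p
      using that by (induction I) auto
    have "y (a, b) = (\<Sum>i<n. \<Sum>j<n. single i j (A $$ (i, j)) (a, b))"
      by (simp add: y_def sum_apply)
    also have "\<dots> = (\<Sum>i<n. \<Sum>j<n. if j = b then (if i = a then A $$ (a, b) else 0) else 0)"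
      by (intro sum.cong) (auto simp: single_def)
    also have "\<dots> = A $$ (a, b)"
      using ab by simp
    finally show "block n (($$) A - y) $$ (a, b) = 0\<^sub>m n n $$ (a, b)"
      using ab by simp
  qed auto
  then have "F (($$) A - y) = 0"
    by (rule block)
  then have "F (($$) A) = F y"
    using add[of "($$) A - y" y] by simp
  also have "\<dots> = mat_pairing n (functional_matrix n F) A"
    by (simp add: y_def F_sum mat_pairing_def functional_matrix_def)
  finally show ?thesis ..
qed

text \<open>
  A real functional \<open>g\<close> that vanishes on skew-adjoint elements complexifies to
  \<open>F x = g x - \<i> g (\<i> x)\<close>, which is hermitian. Its bound is not doubled: rotating \<open>x\<close> by a phase makes
  \<open>F x\<close> real, and \<open>g\<close> is bounded by the norm since the involution is isometric.
\<close>

lemma dominated_functional_matrix: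
  assumes "0 < n" "0 \<le> c" and g: "fr.real_linear g" and dom: "\<And>x. g x \<le> c * upper_norm n x"
  shows "\<exists>f\<in>dual_cone V n. \<forall>A\<in>carrier_mat n n.
    cmod (mat_pairing n f A) \<le> c * mnorm V n A \<and> Re (mat_pairing n f A) = g (($$) A)"
proof -
  note g_simps = fr.real_linear_simps[OF g]
  have g_le: "g x \<le> c * norm_herm n x" for x
    using dom[of x] mult_left_mono[OF upper_norm_le_norm_herm[OF assms(1)] assms(2)] order_trans by blast
  have g_zero: "g x = 0" if "norm_herm n x = 0" for x
  proof -
    have "norm_herm n (- x) = 0"
      using that norm_uminus[OF assms(1)] by (simp add: norm_herm_def herm_minus block_uminus)
    then show ?thesis
      using g_le[of x] g_le[of "- x"] that g_simps(3)[of x] by simp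
  qed
  have block0: "block n 0 = 0\<^sub>m n n"
    by (rule eq_matI) auto
  have g_herm_zero: "g x = 0" if "herm x = 0" for x
    using that norm_zero[OF assms(1)] by (intro g_zero) (simp add: norm_herm_def block0)
  define F where "F = (\<lambda>x. Complex (g x) (- g (fscale \<i> x)))"
  have F_add: "F (x + y) = F x + F y" for x y
    by (simp add: F_def g_simps fs.scale_right_distrib complex_eq_iff)
  have F_scale: "F (fscale z x) = z * F x" for z x
  proof -
    have "fscale z x = fscale (complex_of_real (Re z)) x + fscale (complex_of_real (Im z)) (fscale \<i> x)"
      unfolding fs.scale_scale fs.scale_left_distrib[symmetric]
      by (intro arg_cong2[where f = fscale] refl) (simp add: complex_eq_iff)
    moreover have "fscale \<i> (fscale z x)
        = fscale (complex_of_real (Re z)) (fscale \<i> x) + fscale (complex_of_real (- Im z)) x"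
      unfolding fs.scale_scale fs.scale_left_distrib[symmetric]
      by (intro arg_cong2[where f = fscale] refl) (simp add: complex_eq_iff)
    ultimately show ?thesis
      by (simp only: F_def g_simps) (simp add: complex_eq_iff)
  qed
  have F_bound: "cmod (F x) \<le> c * mnorm V n (block n x)" for x
  proof (cases "F x = 0")
    case True
    then show ?thesis
      using norm_nonneg[OF assms(1)] assms(2) by simp
  next
    case False
    \<comment> \<open>the phase that makes \<open>u * F x\<close> equal to its modulus\<close>
    define u where "u = cnj (F x) / cmod (F x)"
    have u: "cmod u = 1" "u * F x = cmod (F x)"
      using False by (auto simp: u_def norm_divide complex_norm_square[symmetric] power2_eq_square mult.commute)
    have "cmod (F x) = Re (F (fscale u x))"
      using u by (simp add: F_scale)
    also have "\<dots> \<le> c * norm_herm n (fscale u x)"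
      using g_le by (simp add: F_def)
    also have "\<dots> \<le> c * mnorm V n (block n (fscale u x))"
      using norm_herm_le[OF assms(1)] assms(2) by (intro mult_left_mono)
    also have "\<dots> = c * mnorm V n (block n x)"
      using norm_scale[OF assms(1), of "block n x" u] u(1) by (simp add: block_fscale)
    finally show ?thesis .
  qed
  have F_block: "F x = 0" if "block n x = 0\<^sub>m n n" for x
    using F_bound[of x] that norm_zero[OF assms(1)] by simp
  have F_star: "F (fstar x) = cnj (F x)" for x
  proof -
    have "g (fstar x) = g x"
      using g_herm_zero[OF herm_diff_fstar[of x]] by (simp add: g_simps)
    moreover have "g (fscale \<i> (fstar x)) = - g (fscale \<i> x)"
      using g_herm_zero[OF herm_add_fstar_ii[of x]] by (simp add: g_simps fs.scale_right_distrib)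
    ultimately show ?thesis
      by (simp add: F_def complex_eq_iff)
  qed
  define f where "f = functional_matrix n F"
  have pair: "mat_pairing n f A = F (($$) A)" if "A \<in> carrier_mat n n" for A
    unfolding f_def using F_add F_block that by (intro pairing_functional_matrix)
  have "f \<in> mat_dual V n"
  proof -
    have "(\<lambda>v. F (single i j v)) \<in> dual_space V" if ij: "i < n" "j < n" for i j
    proof -
      obtain D where D: "0 \<le> D" "\<And>v. mnorm V n (block n (single i j v)) \<le> D * mnorm V 1 (mat11 v)"
        using single_bounded[OF assms(1) ij] by blast
      have "cmod (F (single i j v)) \<le> (c * D) * mnorm V 1 (mat11 v)" for v
        using F_bound[of "single i j v"] mult_left_mono[OF D(2)[of v] assms(2)] by simp
      then show ?thesis
        unfolding dual_space_iff by (auto simp: single_add single_scale F_add F_scale)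
    qed
    then show ?thesis
      by (simp add: mat_dual_def f_def functional_matrix_def)
  qed
  moreover have "f \<in> mat_sa (dual_star V) n"
    unfolding mat_sa_def f_def functional_matrix_def
    by (simp, rule eq_matI) (simp_all add: dual_star_def F_star[symmetric] fstar_single star_star)
  moreover have "mat_pairing n f A \<in> \<real>\<^sub>\<ge>\<^sub>0" if A: "A \<in> mcone V n" for A
  proof -
    have Ac: "A \<in> carrier_mat n n"
      by (rule cone_carrier[OF assms(1) A])
    have "($$) A \<in> cone_fun n"
      using A block_index[OF Ac] by (simp add: cone_fun_def)
    then have "c * upper_norm n (- ($$) A) \<le> 0"
      using upper_norm_uminus_cone[OF assms(1)] assms(2) by (simp add: mult_nonneg_nonpos)
    then have 1: "0 \<le> g (($$) A)"
      using dom[of "- ($$) A"] by (simp add: g_simps)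
    have "A \<in> mat_sa (vstar V) n"
      using A cone_sa[OF assms(1)] by blast
    then have "block n (fstar (($$) A)) = block n (($$) A)"
      by (simp add: block_fstar block_index[OF Ac] mat_sa_def)
    then have "F (fstar (($$) A)) = F (($$) A)"
      using F_block[of "fstar (($$) A) - ($$) A"] F_add[of "fstar (($$) A) - ($$) A" "($$) A"]
      by (simp add: block_diff)
    then have "F (($$) A) \<in> \<real>"
      by (simp add: F_star Reals_cnj_iff)
    with 1 show ?thesis
      by (simp add: pair[OF Ac] complex_nonneg_Reals_iff F_def complex_is_Real_iff)
  qed
  ultimately have "f \<in> dual_cone V n"
    by (simp add: dual_cone_def)
  moreover have "cmod (mat_pairing n f A) \<le> c * mnorm V n A" if "A \<in> carrier_mat n n" for A
    using F_bound[of "($$) A"] by (simp add: pair[OF that] block_index[OF that])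
  moreover have "Re (mat_pairing n f A) = g (($$) A)" if "A \<in> carrier_mat n n" for A
    by (simp add: pair[OF that] F_def)
  ultimately show ?thesis
    by blast
qed

end

context star_vector_space
begin

lemma pairing_uminus_right:
  assumes "f \<in> mat_dual V n" "A \<in> carrier_mat n n"
  shows "mat_pairing n f (- A) = - mat_pairing n f A"
proof -
  have "- A = map_mat (vscale V (- 1)) A"
    by (rule eq_matI) auto
  then show ?thesis
    using pairing_scale_right[OF assms, of "- 1"] by simp
qed

lemma pairing_eq_of_Re_eq:
  assumes f: "f \<in> mat_dual V n" and g: "g \<in> mat_dual V n"
    and "\<And>A. A \<in> carrier_mat n n \<Longrightarrow> Re (mat_pairing n f A) = Re (mat_pairing n g A)"
  shows "f = g"
proof -
  have eq: "mat_pairing n f A = mat_pairing n g A" if A: "A \<in> carrier_mat n n" for A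
  proof -
    have "Re (mat_pairing n f (map_mat (vscale V \<i>) A)) = Re (mat_pairing n g (map_mat (vscale V \<i>) A))"
      by (rule assms(3)) (use A in simp)
    then show ?thesis
      using assms(3)[OF A] by (simp add: pairing_scale_right[OF _ A] f g complex_eq_iff)
  qed
  have pair_single: "mat_pairing n h (block n (single i j v)) = (h $$ (i, j)) v"
    if h: "h \<in> mat_dual V n" and ij: "i < n" "j < n" for h i j v
  proof -
    have "mat_pairing n h (block n (single i j v))
        = (\<Sum>a<n. \<Sum>b<n. if b = j then (if a = i then (h $$ (i, j)) v else 0) else 0)"
      unfolding mat_pairing_def
      by (intro sum.cong) (auto simp: single_def dual_space_0 mat_dual_entry[OF h])
    then show ?thesis
      using ij by simp
  qed
  show "f = g"
  proof (rule eq_matI)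
    fix i j assume "i < dim_row g" "j < dim_col g"
    then have ij: "i < n" "j < n"
      using mat_dual_carrier[OF g] by auto
    show "f $$ (i, j) = g $$ (i, j)"
    proof (rule ext)
      fix v
      show "(f $$ (i, j)) v = (g $$ (i, j)) v"
        using eq[of "block n (single i j v)"] by (simp add: pair_single[OF f ij] pair_single[OF g ij])
    qed
  qed (use mat_dual_carrier[OF f] mat_dual_carrier[OF g] in auto)
qed

lemma pairing_star_left:
  assumes "f \<in> carrier_mat n n" "A \<in> carrier_mat n n"
  shows "mat_pairing n (mat_star (dual_star V) f) A = cnj (mat_pairing n f (mat_star (vstar V) A))"
proof -
  have "mat_pairing n (mat_star (dual_star V) f) A
      = (\<Sum>i<n. \<Sum>j<n. cnj ((f $$ (j, i)) (vstar V (A $$ (i, j)))))"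
    unfolding mat_pairing_def using assms by (intro sum.cong) (auto simp: dual_star_def)
  also have "\<dots> = (\<Sum>j<n. \<Sum>i<n. cnj ((f $$ (j, i)) (vstar V (A $$ (i, j)))))"
    by (rule sum.swap)
  also have "\<dots> = cnj (mat_pairing n f (mat_star (vstar V) A))"
    unfolding mat_pairing_def cnj_sum using assms by (intro sum.cong) auto
  finally show ?thesis .
qed

lemma pairing_star_right:
  assumes "f \<in> mat_sa (dual_star V) n" "A \<in> carrier_mat n n"
  shows "mat_pairing n f (mat_star (vstar V) A) = cnj (mat_pairing n f A)"
  using pairing_star_left[of f n A] assms by (simp add: mat_sa_def)

lemma dual_cone_mat_sa: "f \<in> dual_cone V n \<Longrightarrow> f \<in> mat_sa (dual_star V) n"
  by (simp add: dual_cone_def)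

lemma dual_space_add_closed:
  assumes "\<phi> \<in> dual_space V" "\<psi> \<in> dual_space V"
  shows "\<phi> + \<psi> \<in> dual_space V"
proof -
  obtain C D where C: "\<And>v. cmod (\<phi> v) \<le> C * mnorm V 1 (mat11 v)"
    and D: "\<And>v. cmod (\<psi> v) \<le> D * mnorm V 1 (mat11 v)"
    using assms by (auto simp: dual_space_iff)
  have "cmod ((\<phi> + \<psi>) v) \<le> (C + D) * mnorm V 1 (mat11 v)" for v
    using norm_triangle_le[OF add_mono[OF C[of v] D[of v]]] by (simp add: distrib_right)
  moreover have "(\<phi> + \<psi>) (v + w) = (\<phi> + \<psi>) v + (\<phi> + \<psi>) w"
    and "(\<phi> + \<psi>) (vscale V c v) = c * (\<phi> + \<psi>) v" for v w c
    using assms by (simp_all add: dual_space_add dual_space_scale algebra_simps)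
  ultimately show ?thesis
    unfolding dual_space_iff by blast
qed

lemma dual_space_scale_closed:
  assumes "\<phi> \<in> dual_space V"
  shows "dual_scale c \<phi> \<in> dual_space V"
proof -
  obtain C where C: "\<And>v. cmod (\<phi> v) \<le> C * mnorm V 1 (mat11 v)"
    using assms by (auto simp: dual_space_iff)
  have "cmod (dual_scale c \<phi> v) \<le> (cmod c * C) * mnorm V 1 (mat11 v)" for v
    using mult_left_mono[OF C[of v], of "cmod c"] by (simp add: dual_scale_def norm_mult)
  moreover have "dual_scale c \<phi> (v + w) = dual_scale c \<phi> v + dual_scale c \<phi> w"
    and "dual_scale c \<phi> (vscale V d v) = d * dual_scale c \<phi> v" for v w d
    using assms by (simp_all add: dual_scale_def dual_space_add dual_space_scale algebra_simps)
  ultimately show ?thesis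
    unfolding dual_space_iff by blast
qed

lemma mat_dual_add: "f \<in> mat_dual V n \<Longrightarrow> g \<in> mat_dual V n \<Longrightarrow> f + g \<in> mat_dual V n"
  by (auto simp: mat_dual_def dual_space_add_closed)

lemma mat_dual_scale: "f \<in> mat_dual V n \<Longrightarrow> map_mat (dual_scale c) f \<in> mat_dual V n"
  by (auto simp: mat_dual_def dual_space_scale_closed)

end

lemma dual_star_add: "dual_star V (\<phi> + \<psi>) = dual_star V \<phi> + dual_star V \<psi>"
  by (rule ext) (simp add: dual_star_def)

lemma dual_star_scale: "dual_star V (dual_scale c \<phi>) = dual_scale (cnj c) (dual_star V \<phi>)"
  by (rule ext) (simp add: dual_star_def dual_scale_def)

lemma mat_star_dual_add:
  assumes "f \<in> carrier_mat n n" "g \<in> carrier_mat n n"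
  shows "mat_star (dual_star V) (f + g) = mat_star (dual_star V) f + mat_star (dual_star V) g"
  by (rule eq_matI) (use assms in \<open>auto simp: dual_star_add\<close>)

lemma mat_star_dual_scale:
  "mat_star (dual_star V) (map_mat (dual_scale c) f) = map_mat (dual_scale (cnj c)) (mat_star (dual_star V) f)"
  by (rule eq_matI) (auto simp: dual_star_scale)

context cstar_ordered_operator_space
begin

lemma dual_space_star_closed:
  assumes "\<phi> \<in> dual_space V"
  shows "dual_star V \<phi> \<in> dual_space V"
proof -
  obtain C where C: "\<And>v. cmod (\<phi> v) \<le> C * mnorm V 1 (mat11 v)"
    using assms unfolding dual_space_iff by blast
  have "mnorm V 1 (mat11 (vstar V v)) = mnorm V 1 (mat11 v)" for v
  proof -
    have "mat_star (vstar V) (mat11 v) = mat11 (vstar V v)"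
      by (rule eq_matI) (simp_all add: mat11_def mat_star_def)
    then show ?thesis
      using star_isometry[of 1 "mat11 v"] by simp
  qed
  then have "cmod (dual_star V \<phi> v) \<le> C * mnorm V 1 (mat11 v)" for v
    using C[of "vstar V v"] by (simp add: dual_star_def)
  then have "\<exists>C. \<forall>v. cmod (dual_star V \<phi> v) \<le> C * mnorm V 1 (mat11 v)"
    by (intro exI[of _ C] allI)
  moreover have "dual_star V \<phi> (v + w) = dual_star V \<phi> v + dual_star V \<phi> w" for v w
    by (simp add: dual_star_def star_add dual_space_add[OF assms])
  moreover have "dual_star V \<phi> (vscale V c v) = c * dual_star V \<phi> v" for v c
    by (simp add: dual_star_def star_scale dual_space_scale[OF assms])
  ultimately show ?thesis
    unfolding dual_space_iff by (intro conjI allI)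
qed

lemma mat_dual_star: "f \<in> mat_dual V n \<Longrightarrow> mat_star (dual_star V) f \<in> mat_dual V n"
  by (auto simp: mat_dual_def dual_space_star_closed)

lemma dual_cone_add:
  assumes "f \<in> dual_cone V n" "g \<in> dual_cone V n"
  shows "f + g \<in> dual_cone V n"
  using assms
  by (auto simp: dual_cone_def mat_dual_add mat_sa_def mat_star_dual_add pairing_add_left[of _ n])

lemma dual_cone_scale:
  assumes "f \<in> dual_cone V n" "0 \<le> r"
  shows "map_mat (dual_scale (complex_of_real r)) f \<in> dual_cone V n"
  using assms
  by (auto simp: dual_cone_def mat_dual_scale mat_sa_def mat_star_dual_scale pairing_scale_left[of _ n])

lemma Q_set_convex:
  assumes "0 < n" "f \<in> Q_set V n" "g \<in> Q_set V n" "0 \<le> t" "t \<le> 1"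
  shows "map_mat (dual_scale (complex_of_real (1 - t))) f + map_mat (dual_scale (complex_of_real t)) g \<in> Q_set V n"
    (is "?h \<in> _")
proof -
  have fg: "f \<in> carrier_mat n n" "g \<in> carrier_mat n n"
    using assms(2,3) Q_set_mat_dual mat_dual_carrier by blast+
  have "cmod (mat_pairing n ?h A) \<le> mnorm V n A" if A: "A \<in> carrier_mat n n" for A
  proof -
    have eq: "mat_pairing n ?h A = complex_of_real (1 - t) * mat_pairing n f A + complex_of_real t * mat_pairing n g A"
      using fg by (simp add: pairing_add_left[of _ n] pairing_scale_left[of _ n])
    have "cmod (mat_pairing n ?h A)
        \<le> cmod (complex_of_real (1 - t) * mat_pairing n f A) + cmod (complex_of_real t * mat_pairing n g A)"
      unfolding eq by (rule norm_triangle_ineq)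
    also have "\<dots> = (1 - t) * cmod (mat_pairing n f A) + t * cmod (mat_pairing n g A)"
      unfolding norm_mult norm_of_real using assms(4,5) by simp
    also have "\<dots> \<le> (1 - t) * mnorm V n A + t * mnorm V n A"
      using assms A by (intro add_mono mult_left_mono) (auto simp: Q_set_iff)
    finally show ?thesis
      by (simp add: algebra_simps)
  qed
  moreover have "?h \<in> dual_cone V n"
    using assms by (intro dual_cone_add dual_cone_scale) (auto simp: Q_set_def)
  ultimately show ?thesis
    by (simp add: Q_set_iff[OF assms(1)])
qed

lemma Q_set_scaled:
  assumes "0 < n" "f \<in> dual_cone V n" "0 < c" "\<And>A. A \<in> carrier_mat n n \<Longrightarrow> cmod (mat_pairing n f A) \<le> c * mnorm V n A"
  shows "map_mat (dual_scale (complex_of_real (1 / c))) f \<in> Q_set V n"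
proof -
  have f: "f \<in> carrier_mat n n"
    using assms(2) mat_dual_carrier by (auto simp: dual_cone_def)
  have "map_mat (dual_scale (complex_of_real (1 / c))) f \<in> dual_cone V n"
    using assms(2,3) by (intro dual_cone_scale) auto
  moreover have "cmod (mat_pairing n (map_mat (dual_scale (complex_of_real (1 / c))) f) A) \<le> mnorm V n A"
    if "A \<in> carrier_mat n n" for A
    unfolding pairing_scale_left[OF f] norm_mult norm_of_real
    using assms(4)[OF that] assms(3) by (simp add: field_simps)
  ultimately show ?thesis
    by (simp add: Q_set_iff[OF assms(1)])
qed

lemma upper_norm_nonneg:
  assumes "0 < n"
  shows "0 \<le> upper_norm n x"
  unfolding upper_norm_def
  using cone_fun_convex_cone[OF assms] norm_herm_nonneg[OF assms]
  by (intro cINF_greatest) (auto simp: fr.convex_cone_def)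

lemma Q_set_attains_upper_norm:
  assumes "0 < n" and A: "A \<in> carrier_mat n n"
  shows "\<exists>f\<in>Q_set V n. Re (mat_pairing n f A) = upper_norm n (($$) A)"
proof -
  obtain g where g: "fr.real_linear g" "\<forall>x. g x \<le> upper_norm n x" "g (($$) A) = upper_norm n (($$) A)"
    using fr.hahn_banach_touching[OF upper_norm_sublinear[OF assms(1)], where ?x0.0 = "($$) A"]
    by (elim exE conjE) (rule that)
  have dom: "g x \<le> 1 * upper_norm n x" for x
    using g(2) by simp
  obtain f where f: "f \<in> dual_cone V n" "\<forall>A\<in>carrier_mat n n.
      cmod (mat_pairing n f A) \<le> 1 * mnorm V n A \<and> Re (mat_pairing n f A) = g (($$) A)"
    by (rule bexE[OF dominated_functional_matrix[where c = 1 and g = g, OF assms(1) zero_le_one g(1) dom]])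
  then have "f \<in> Q_set V n"
    by (simp add: Q_set_iff[OF assms(1)])
  moreover have "Re (mat_pairing n f A) = upper_norm n (($$) A)"
    using f(2) A g(3) by simp
  ultimately show ?thesis
    by blast
qed

lemma upper_norm_cong:
  assumes "block n x = block n y"
  shows "upper_norm n x = upper_norm n y"
  unfolding upper_norm_def norm_herm_def
  using assms block_herm_cong[OF assms] by (simp add: herm_add block_add)

text \<open>
  Either \<open>A\<close> or \<open>- A\<close> has upper norm equal to the norm of \<open>A\<close>, and the upper norm is attained on \<open>Q\<^sub>n(V)\<close>
  by the Hahn-Banach theorem.
\<close>

lemma Q_set_norming:
  assumes "0 < n" "A \<in> mat_sa (vstar V) n"
  shows "\<exists>f\<in>Q_set V n. cmod (mat_pairing n f A) = mnorm V n A"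
proof -
  have A: "A \<in> carrier_mat n n"
    using assms(2) by (simp add: mat_sa_def)
  have "norm_herm n (($$) A) = mnorm V n A"
    using block_herm_of_sa[of n "($$) A"] assms(2) by (simp add: norm_herm_def block_index[OF A])
  then have max: "mnorm V n A \<le> max (upper_norm n (($$) A)) (upper_norm n (- ($$) A))"
    using norm_herm_le_upper_norm[OF assms(1), of "($$) A"] by simp
  have mA: "- A \<in> carrier_mat n n"
    using A by simp
  have "block n (- ($$) A) = block n (($$) (- A))"
    using block_index[OF A] block_index[OF mA] by (simp add: block_uminus)
  then have um: "upper_norm n (- ($$) A) = upper_norm n (($$) (- A))"
    by (rule upper_norm_cong)
  obtain f where f: "f \<in> Q_set V n" "Re (mat_pairing n f A) = upper_norm n (($$) A)"
    using Q_set_attains_upper_norm[OF assms(1) A] by blast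
  obtain g where g: "g \<in> Q_set V n" "Re (mat_pairing n g (- A)) = upper_norm n (- ($$) A)"
    using Q_set_attains_upper_norm[OF assms(1) mA] unfolding um by blast
  have "mat_pairing n g (- A) = - mat_pairing n g A"
    by (rule pairing_uminus_right[OF Q_set_mat_dual[OF g(1)] A])
  then have "mnorm V n A \<le> cmod (mat_pairing n f A) \<or> mnorm V n A \<le> cmod (mat_pairing n g A)"
    using max f(2) g(2) abs_Re_le_cmod[of "mat_pairing n f A"] abs_Re_le_cmod[of "mat_pairing n g A"] by auto
  moreover have "cmod (mat_pairing n f A) \<le> mnorm V n A" "cmod (mat_pairing n g A) \<le> mnorm V n A"
    using f(1) g(1) A by (auto simp: Q_set_iff[OF assms(1)])
  ultimately have "cmod (mat_pairing n f A) = mnorm V n A \<or> cmod (mat_pairing n g A) = mnorm V n A"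
    by linarith
  then show ?thesis
    using f(1) g(1) by blast
qed

lemma Q_set_separates_cone:
  assumes "0 < n" "A \<in> mat_sa (vstar V) n" "A \<notin> mcone V n"
  shows "\<exists>f\<in>Q_set V n. Re (mat_pairing n f A) < 0"
proof -
  have A: "A \<in> carrier_mat n n" "- A \<in> carrier_mat n n"
    using assms(2) by (simp_all add: mat_sa_def)
  have "block n (- ($$) A) = block n (($$) (- A))"
    using block_index[OF A(1)] block_index[OF A(2)] by (simp add: block_uminus)
  then have "0 < upper_norm n (($$) (- A))"
    using upper_norm_pos_outside_cone[OF assms] upper_norm_cong[of n "- ($$) A" "($$) (- A)"] by simp
  then obtain f where f: "f \<in> Q_set V n" "0 < Re (mat_pairing n f (- A))"
    using Q_set_attains_upper_norm[OF assms(1) A(2)] by auto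
  have "mat_pairing n f (- A) = - mat_pairing n f A"
    by (rule pairing_uminus_right[OF Q_set_mat_dual[OF f(1)] A(1)])
  with f show ?thesis
    by force
qed

text \<open>
  The Jordan decomposition of hermitian functionals, up to a constant: since
  \<open>\<parallel>x\<parallel> \<le> max (upper_norm n x) (upper_norm n (- x))\<close>, a bounded functional is dominated by a multiple of
  \<open>upper_norm n x + upper_norm n (- x)\<close> and is a difference of two functionals that are each
  dominated by a multiple of the upper norm alone, hence positive.
\<close>

lemma mat_sa_dual_decomposition:
  assumes "0 < n" and f: "f \<in> mat_dual V n" "f \<in> mat_sa (dual_star V) n"
  shows "\<exists>c. \<exists>g\<in>Q_set V n. \<exists>h\<in>Q_set V n.
    f = map_mat (dual_scale (complex_of_real c)) g + map_mat (dual_scale (complex_of_real (- c))) h"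
proof -
  obtain C0 where C0: "0 \<le> C0" "\<forall>A\<in>carrier_mat n n. cmod (mat_pairing n f A) \<le> C0 * mnorm V n A"
    using pairing_bounded[OF assms(1) f(1)] by blast
  \<comment> \<open>a strictly positive bound, by which the functionals found below can be divided\<close>
  define C where "C = C0 + 1"
  have Cpos: "0 < C"
    using C0(1) by (simp add: C_def)
  have C: "cmod (mat_pairing n f A) \<le> C * mnorm V n A" if "A \<in> carrier_mat n n" for A
    using C0(2)[rule_format, OF that] norm_nonneg[OF assms(1) that] by (simp add: C_def distrib_right)
  define p where "p = (\<lambda>x. C * upper_norm n x)"
  define \<rho> where "\<rho> = (\<lambda>x. Re (mat_pairing n f (block n x)))"
  note U = upper_norm_sublinear[OF assms(1)]
  have p: "fr.sublinear p"
    unfolding fr.sublinear_on_def p_def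
    using Cpos fr.sublinear_add[OF U] fr.sublinear_scale[OF U]
    by (auto simp: mult.left_commute simp flip: distrib_left)
  have \<rho>: "fr.real_linear \<rho>"
    unfolding fr.real_linear_def \<rho>_def
    by (auto simp: block_add block_fscale pairing_add_right[OF f(1)] pairing_scale_right[OF f(1)])
  have "\<rho> (fstar x) = \<rho> x" for x
    using pairing_star_right[OF f(2), of "block n x"] by (simp add: \<rho>_def block_fstar)
  then have \<rho>_star: "\<rho> (fstar x) = \<rho> x" for x .
  have \<rho>_herm: "\<rho> (herm x) = \<rho> x" for x
  proof -
    have "\<rho> (herm x) = (1 / 2) * \<rho> (x + fstar x)"
      using fr.real_linear_simps(2)[OF \<rho>, of "1 / 2" "x + fstar x"] by (simp add: herm_def)
    then show ?thesis
      using \<rho>_star[of x] by (simp add: fr.real_linear_simps(1)[OF \<rho>])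
  qed
  have dom: "\<rho> x \<le> p x + p (- x)" for x
  proof -
    have "\<rho> x \<le> cmod (mat_pairing n f (block n (herm x)))"
      using \<rho>_herm[of x] complex_Re_le_cmod[of "mat_pairing n f (block n (herm x))"] by (simp add: \<rho>_def)
    also have "\<dots> \<le> C * norm_herm n x"
      using C[of "block n (herm x)"] by (simp add: norm_herm_def)
    also have "\<dots> \<le> C * (upper_norm n x + upper_norm n (- x))"
      using norm_herm_le_upper_norm[OF assms(1), of x] upper_norm_nonneg[OF assms(1), of x]
        upper_norm_nonneg[OF assms(1), of "- x"] Cpos by (intro mult_left_mono) auto
    finally show ?thesis
      by (simp add: p_def distrib_left)
  qed
  obtain g' h' where gh: "fr.real_linear g'" "fr.real_linear h'" "\<And>x. g' x \<le> p x" "\<And>x. h' x \<le> p x"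
    "\<And>x. \<rho> x = g' x - h' x"
    using fr.linear_difference_of_dominated[where p = p and f = \<rho>, OF p \<rho> dom] by blast
  obtain G where G: "G \<in> dual_cone V n" "\<forall>A\<in>carrier_mat n n.
      cmod (mat_pairing n G A) \<le> C * mnorm V n A \<and> Re (mat_pairing n G A) = g' (($$) A)"
    using dominated_functional_matrix[where c = C and g = g', OF assms(1) less_imp_le[OF Cpos] gh(1) gh(3)[unfolded p_def]] by blast
  obtain H where H: "H \<in> dual_cone V n" "\<forall>A\<in>carrier_mat n n.
      cmod (mat_pairing n H A) \<le> C * mnorm V n A \<and> Re (mat_pairing n H A) = h' (($$) A)"
    using dominated_functional_matrix[where c = C and g = h', OF assms(1) less_imp_le[OF Cpos] gh(2) gh(4)[unfolded p_def]] by blast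
  define g where "g = map_mat (dual_scale (complex_of_real (1 / C))) G"
  define h where "h = map_mat (dual_scale (complex_of_real (1 / C))) H"
  have Q: "g \<in> Q_set V n" "h \<in> Q_set V n"
    unfolding g_def h_def
    by (rule Q_set_scaled[OF assms(1) G(1) Cpos], use G(2) in simp)
      (rule Q_set_scaled[OF assms(1) H(1) Cpos], use H(2) in simp)
  have GH: "G \<in> carrier_mat n n" "H \<in> carrier_mat n n"
    using G(1) H(1) mat_dual_carrier by (auto simp: dual_cone_def)
  have "f = map_mat (dual_scale (complex_of_real C)) g + map_mat (dual_scale (complex_of_real (- C))) h"
  proof (rule pairing_eq_of_Re_eq[OF f(1)])
    show "map_mat (dual_scale (complex_of_real C)) g + map_mat (dual_scale (complex_of_real (- C))) h \<in> mat_dual V n"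
      using Q by (intro mat_dual_add mat_dual_scale Q_set_mat_dual)
    fix A :: "'v mat" assume A: "A \<in> carrier_mat n n"
    have "Re (mat_pairing n f A) = Re (mat_pairing n G A) - Re (mat_pairing n H A)"
      using gh(5)[of "($$) A"] G(2) H(2) A by (simp add: \<rho>_def block_index[OF A])
    also have "\<dots> = Re (mat_pairing n (map_mat (dual_scale (complex_of_real C)) g + map_mat (dual_scale (complex_of_real (- C))) h) A)"
      using GH Cpos by (simp add: g_def h_def pairing_add_left[of _ n] pairing_scale_left[of _ n])
    finally show "Re (mat_pairing n f A) = Re (mat_pairing n (map_mat (dual_scale (complex_of_real C)) g + map_mat (dual_scale (complex_of_real (- C))) h) A)" .
  qed
  then show ?thesis
    by (intro exI[of _ C] bexI[OF _ Q(1)] bexI[OF _ Q(2)])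
qed

text \<open>
  The linear span of \<open>Q\<^sub>n(V)\<close> is all of \<open>M\<^sub>n(V\<^sup>*)\<close>. It is stated through functionals because this is the form
  that gives uniqueness of linear extensions from \<open>Q\<^sub>n(V)\<close>.
\<close>

lemma Q_set_spans_mat_dual:
  assumes "0 < n"
    and add: "\<And>f g. f \<in> mat_dual V n \<Longrightarrow> g \<in> mat_dual V n \<Longrightarrow> b (f + g) = b f + b g"
    and scale: "\<And>c f. f \<in> mat_dual V n \<Longrightarrow> b (map_mat (dual_scale c) f) = (c :: complex) * b f"
    and zero: "\<And>f. f \<in> Q_set V n \<Longrightarrow> b f = 0"
    and f: "f \<in> mat_dual V n"
  shows "b f = 0"
proof -
  have sa: "b f = 0" if f: "f \<in> mat_dual V n" "f \<in> mat_sa (dual_star V) n" for f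
  proof -
    obtain c g h where *: "g \<in> Q_set V n" "h \<in> Q_set V n"
      "f = map_mat (dual_scale (complex_of_real c)) g + map_mat (dual_scale (complex_of_real (- c))) h"
      using mat_sa_dual_decomposition[OF assms(1) f] by (elim exE bexE) (rule that)
    have "b f = complex_of_real c * b g + complex_of_real (- c) * b h"
      unfolding *(3) using *(1,2)
      by (simp only: add scale mat_dual_scale Q_set_mat_dual)
    then show ?thesis
      using zero *(1,2) by simp
  qed
  let ?s = "mat_star (dual_star V)"
  have ss: "?s (?s g) = g" if "g \<in> carrier_mat n n" for g
    using that by (intro eq_matI) (auto simp: dual_star_def star_star)
  have star: "b (g + ?s g) = 0" if g: "g \<in> mat_dual V n" for g
  proof (rule sa)
    show "g + ?s g \<in> mat_dual V n"
      by (intro mat_dual_add g mat_dual_star)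
    have gc: "g \<in> carrier_mat n n"
      by (rule mat_dual_carrier[OF g])
    then have "?s (g + ?s g) = g + ?s g"
      using comm_add_mat[OF gc, of "?s g"] by (simp add: mat_star_dual_add[of _ n] ss)
    then show "g + ?s g \<in> mat_sa (dual_star V) n"
      using gc by (simp add: mat_sa_def)
  qed
  have "b f + b (?s f) = 0"
    using star[OF f] by (simp add: add f mat_dual_star)
  moreover have "\<i> * b f - \<i> * b (?s f) = 0"
    using star[OF mat_dual_scale[OF f, of \<i>]]
    by (simp add: add f mat_dual_star mat_dual_scale mat_star_dual_scale scale)
  ultimately show ?thesis
    by (simp add: complex_eq_iff)
qed

text \<open>
  \<open>A + A\<^sup>*\<close> and \<open>\<i> A + (\<i> A)\<^sup>*\<close> are self-adjoint and annihilated by \<open>Q\<^sub>n(V)\<close>, hence zero because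
  \<open>Q\<^sub>n(V)\<close> is norming on self-adjoint elements.
\<close>

lemma Q_set_separates_points:
  assumes "0 < n" "A \<in> carrier_mat n n" "\<And>f. f \<in> Q_set V n \<Longrightarrow> mat_pairing n f A = 0"
  shows "A = 0\<^sub>m n n"
proof -
  have sa: "B + mat_star (vstar V) B = 0\<^sub>m n n"
    if B: "B \<in> carrier_mat n n" and zero: "\<And>f. f \<in> Q_set V n \<Longrightarrow> mat_pairing n f B = 0" for B
  proof -
    let ?S = "B + mat_star (vstar V) B"
    have "mat_star (vstar V) ?S = ?S"
      using B by (intro eq_matI) (auto simp: star_add star_star add.commute)
    then have S: "?S \<in> mat_sa (vstar V) n"
      using B by (simp add: mat_sa_def)
    have "mat_pairing n f ?S = 0" if "f \<in> Q_set V n" for f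
      using that B zero[OF that] pairing_star_right[of f n B]
      by (simp add: pairing_add_right Q_set_mat_dual dual_cone_mat_sa Q_set_def)
    then have "mnorm V n ?S = 0"
      using Q_set_norming[OF assms(1) S] by auto
    then show ?thesis
      using norm_eq_0[OF assms(1), of ?S] B by simp
  qed
  let ?B = "map_mat (vscale V \<i>) A"
  have 1: "A + mat_star (vstar V) A = 0\<^sub>m n n"
    using assms by (intro sa) auto
  have 2: "?B + mat_star (vstar V) ?B = 0\<^sub>m n n"
    using assms by (intro sa) (auto simp: pairing_scale_right Q_set_mat_dual)
  show ?thesis
  proof (rule eq_matI)
    fix i j assume "i < dim_row (0\<^sub>m n n :: 'v mat)" "j < dim_col (0\<^sub>m n n :: 'v mat)"
    then have ij: "i < n" "j < n"
      by auto
    let ?v = "A $$ (i, j)" and ?w = "vstar V (A $$ (j, i))"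
    have "?v + ?w = 0"
      using arg_cong[OF 1, of "\<lambda>M. M $$ (i, j)"] ij assms(2) by simp
    moreover have "vscale V \<i> ?v + vscale V (- \<i>) ?w = 0"
      using arg_cong[OF 2, of "\<lambda>M. M $$ (i, j)"] ij assms(2) by (simp add: star_scale)
    then have "vscale V \<i> (?v - ?w) = 0"
      by (simp add: vs.scale_right_diff_distrib)
    ultimately have "vscale V 2 ?v = 0"
      using vs.scale_left_distrib[of 1 1 ?v] by simp
    then show "A $$ (i, j) = 0\<^sub>m n n $$ (i, j)"
      using ij by simp
  qed (use assms(2) in auto)
qed

end

context star_vector_space
begin

section \<open>Weak-star continuous functionals are evaluations\<close>

text \<open>
  Induction on the number of evaluations, over all subspaces \<open>W\<close> at once: the hypothesis is used on the
  kernel of one evaluation in \<open>W\<close>, and the remaining discrepancy is then a multiple of that evaluation.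
\<close>

lemma finite_joint_kernel_functional:
  assumes "finite S" "S \<subseteq> carrier_mat n n"
    and W: "W \<subseteq> mat_dual V n" "\<And>f g. f \<in> W \<Longrightarrow> g \<in> W \<Longrightarrow> f + g \<in> W"
      "\<And>c f. f \<in> W \<Longrightarrow> map_mat (dual_scale c) f \<in> W"
    and add: "\<And>f g. f \<in> W \<Longrightarrow> g \<in> W \<Longrightarrow> b (f + g) = b f + b g"
    and scale: "\<And>c f. f \<in> W \<Longrightarrow> b (map_mat (dual_scale c) f) = (c :: complex) * b f"
    and zero: "\<And>f. f \<in> W \<Longrightarrow> \<forall>A\<in>S. mat_pairing n f A = 0 \<Longrightarrow> b f = 0"
  shows "\<exists>B\<in>carrier_mat n n. \<forall>f\<in>W. b f = mat_pairing n f B"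
  using assms
proof (induction S arbitrary: W rule: finite_induct)
  case empty
  then have "\<forall>f\<in>W. b f = mat_pairing n f (0\<^sub>m n n)"
    by (auto simp: pairing_zero_right)
  then show ?case
    using zero_carrier_mat by blast
next
  case (insert A S)
  note Wd = insert.prems(2) and W_add = insert.prems(3) and W_scale = insert.prems(4)
    and b_add = insert.prems(5) and b_scale = insert.prems(6) and b_zero = insert.prems(7)
  have A: "A \<in> carrier_mat n n"
    using insert.prems(1) by simp
  have Wc: "f \<in> carrier_mat n n" if "f \<in> W" for f
    using Wd that mat_dual_carrier by blast
  define W' where "W' = {f \<in> W. mat_pairing n f A = 0}"
  have "\<exists>B\<in>carrier_mat n n. \<forall>f\<in>W'. b f = mat_pairing n f B"
  proof (rule insert.IH)
    show "S \<subseteq> carrier_mat n n" "W' \<subseteq> mat_dual V n"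
      using insert.prems(1) Wd by (auto simp: W'_def)
    show "f + g \<in> W'" if "f \<in> W'" "g \<in> W'" for f g
      using that W_add Wc by (simp add: W'_def pairing_add_left)
    show "map_mat (dual_scale c) f \<in> W'" if "f \<in> W'" for c f
      using that W_scale Wc by (simp add: W'_def pairing_scale_left)
    show "b (f + g) = b f + b g" if "f \<in> W'" "g \<in> W'" for f g
      using that b_add by (simp add: W'_def)
    show "b (map_mat (dual_scale c) f) = c * b f" if "f \<in> W'" for c f
      using that b_scale by (simp add: W'_def)
    show "b f = 0" if "f \<in> W'" "\<forall>A\<in>S. mat_pairing n f A = 0" for f
      using that b_zero by (simp add: W'_def)
  qed
  then obtain B where B: "B \<in> carrier_mat n n" "\<And>f. f \<in> W' \<Longrightarrow> b f = mat_pairing n f B"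
    by blast
  show ?case
  proof (cases "\<exists>w\<in>W. mat_pairing n w A \<noteq> 0")
    case False
    then have "W' = W"
      by (auto simp: W'_def)
    then show ?thesis
      using B by blast
  next
    case True
    then obtain w where w: "w \<in> W" "mat_pairing n w A \<noteq> 0"
      by blast
    define t where "t = mat_pairing n w A"
    define s where "s = (b w - mat_pairing n w B) / t"
    let ?C = "B + map_mat (vscale V s) A"
    have "b f = mat_pairing n f ?C" if f: "f \<in> W" for f
    proof -
      define r where "r = mat_pairing n f A / t"
      \<comment> \<open>the component of \<open>f\<close> along \<open>w\<close> is removed, so that the evaluation at \<open>A\<close> vanishes\<close>
    let ?h = "f + map_mat (dual_scale (- r)) w"
      have pair: "mat_pairing n ?h X = mat_pairing n f X - r * mat_pairing n w X" for X
        using Wc[OF f] Wc[OF w(1)] by (simp add: pairing_add_left[of _ n] pairing_scale_left)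
      have "?h \<in> W'"
        using W_add[OF f W_scale[OF w(1)]] pair[of A] w(2) by (simp add: W'_def r_def t_def)
      then have "b ?h = mat_pairing n ?h B"
        by (rule B(2))
      moreover have "b ?h = b f - r * b w"
        using b_add[OF f W_scale[OF w(1)]] b_scale[OF w(1)] by simp
      ultimately have "b f = mat_pairing n f B + r * (b w - mat_pairing n w B)"
        by (simp add: pair algebra_simps)
      also have "r * (b w - mat_pairing n w B) = s * mat_pairing n f A"
        by (simp add: r_def s_def)
      also have "mat_pairing n f B + s * mat_pairing n f A = mat_pairing n f ?C"
        using f Wd A B(1) by (simp add: pairing_add_right[of f n] pairing_scale_right subset_iff)
      finally show ?thesis .
    qed
    moreover have "?C \<in> carrier_mat n n"
      using A by simp
    ultimately show ?thesis
      by blast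
  qed
qed

lemma mat_dual_zero: "0\<^sub>m n n \<in> mat_dual V n"
proof -
  have "(0 :: 'v \<Rightarrow> complex) \<in> dual_space V"
    unfolding dual_space_iff by (auto intro: exI[of _ 0])
  then show ?thesis
    by (simp add: mat_dual_def)
qed

lemma pairing_zero_left: "mat_pairing n (0\<^sub>m n n) A = 0"
  by (simp add: mat_pairing_def)

lemma topspace_wstar: "topspace (wstar_topology V n) = mat_dual V n"
  by (auto simp: wstar_topology_def topspace_pullback_topology)

lemma continuous_map_pairing:
  assumes "A \<in> carrier_mat n n"
  shows "continuous_map (wstar_topology V n) euclidean (\<lambda>f\<in>mat_dual V n. mat_pairing n f A)"
proof -
  have "continuous_map (product_topology (\<lambda>_. euclidean) (carrier_mat n n)) euclidean (\<lambda>x :: 'v mat \<Rightarrow> complex. x A)"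
    by (rule continuous_map_product_projection[OF assms])
  from continuous_map_pullback[OF this]
  have "continuous_map (wstar_topology V n) euclidean
      ((\<lambda>x. x A) \<circ> (\<lambda>f. \<lambda>A\<in>carrier_mat n n. mat_pairing n f A))"
    unfolding wstar_topology_def .
  then show ?thesis
    by (rule continuous_map_eq) (use assms in \<open>simp add: topspace_wstar\<close>)
qed

text \<open>
  The unit ball has an open preimage, which contains a basic neighbourhood of zero. That neighbourhood
  restricts only finitely many evaluations, so \<open>b\<close> is bounded, and by scaling zero, on their joint kernel.
\<close>

lemma wstar_continuous_linear_is_pairing:
  assumes b: "continuous_map (wstar_topology V n) euclidean b"
    and add: "\<And>f g. f \<in> mat_dual V n \<Longrightarrow> g \<in> mat_dual V n \<Longrightarrow> b (f + g) = b f + b g"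
    and scale: "\<And>c f. f \<in> mat_dual V n \<Longrightarrow> b (map_mat (dual_scale c) f) = (c :: complex) * b f"
  shows "\<exists>B\<in>carrier_mat n n. \<forall>f\<in>mat_dual V n. b f = mat_pairing n f B"
proof -
  let ?\<Phi> = "\<lambda>f :: ('v \<Rightarrow> complex) mat. \<lambda>A\<in>carrier_mat n n. mat_pairing n f A"
  have b0: "b (0\<^sub>m n n) = 0"
  proof -
    have "map_mat (dual_scale 0) (0\<^sub>m n n) = (0\<^sub>m n n :: ('v \<Rightarrow> complex) mat)"
      by (rule eq_matI) (auto simp: dual_scale_def)
    then show ?thesis
      using scale[OF mat_dual_zero, where c = 0] by simp
  qed
  have "openin (wstar_topology V n) {f \<in> topspace (wstar_topology V n). b f \<in> {z. cmod z < 1}}"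
    by (rule openin_continuous_map_preimage[OF b]) (simp, intro open_Collect_less continuous_intros)
  then obtain U where U: "openin (product_topology (\<lambda>_. euclidean) (carrier_mat n n)) U"
    "{f \<in> mat_dual V n. b f \<in> {z. cmod z < 1}} = ?\<Phi> -` U \<inter> mat_dual V n"
    by (auto simp: wstar_topology_def openin_pullback_topology topspace_wstar[unfolded wstar_topology_def])
  have "0\<^sub>m n n \<in> {f \<in> mat_dual V n. b f \<in> {z. cmod z < 1}}"
    using b0 mat_dual_zero by simp
  then have "?\<Phi> (0\<^sub>m n n) \<in> U"
    unfolding U(2) by simp
  from product_topology_open_contains_basis[OF U(1) this]
  obtain X where X: "?\<Phi> (0\<^sub>m n n) \<in> (\<Pi>\<^sub>E A\<in>carrier_mat n n. X A)" "finite {A. X A \<noteq> UNIV}"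
    "(\<Pi>\<^sub>E A\<in>carrier_mat n n. X A) \<subseteq> U"
    by auto
  define S where "S = {A \<in> carrier_mat n n. X A \<noteq> UNIV}"
  have X0: "0 \<in> X A" if "A \<in> carrier_mat n n" for A
    using PiE_mem[OF X(1) that] that by (simp add: pairing_zero_left)
  have small: "cmod (b f) < 1" if f: "f \<in> mat_dual V n" "\<forall>A\<in>S. mat_pairing n f A = 0" for f
  proof -
    have "?\<Phi> f \<in> (\<Pi>\<^sub>E A\<in>carrier_mat n n. X A)"
    proof (rule PiE_I)
      fix A :: "'v mat" assume A: "A \<in> carrier_mat n n"
      show "?\<Phi> f A \<in> X A"
        using f(2) A X0[OF A] by (cases "A \<in> S") (auto simp: S_def)
    qed simp
    then have "f \<in> ?\<Phi> -` U \<inter> mat_dual V n"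
      using X(3) f(1) by blast
    then show ?thesis
      unfolding U(2)[symmetric] by simp
  qed
  have zero: "b f = 0" if f: "f \<in> mat_dual V n" "\<forall>A\<in>S. mat_pairing n f A = 0" for f
  proof (rule ccontr)
    assume nz: "b f \<noteq> 0"
    let ?g = "map_mat (dual_scale (inverse (b f))) f"
    have "cmod (b ?g) < 1"
      using f mat_dual_carrier[OF f(1)] by (intro small mat_dual_scale) (simp_all add: pairing_scale_left)
    then show False
      using nz by (simp add: scale[OF f(1)])
  qed
  have "finite S" "S \<subseteq> carrier_mat n n"
    using finite_subset[OF _ X(2), of S] by (auto simp: S_def)
  from finite_joint_kernel_functional[OF this subset_refl mat_dual_add mat_dual_scale add scale zero]
  show ?thesis
    by blast
qed

end

section \<open>The evaluation map\<close>

context cstar_ordered_operator_space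
begin

text \<open>
  \<open>evaluation n\<close> is the map \<open>\<Gamma>\<^sub>n\<close> after identification of \<open>M\<^sub>n(A\<^sub>0(Q\<^sub>1(V), V\<^sup>*))\<close> with
  \<open>A\<^sub>0(Q\<^sub>n(V), M\<^sub>n(V\<^sup>*))\<close>; see \<open>A0_ident_Gamma\<close>.
\<close>

definition evaluation :: "nat \<Rightarrow> 'v mat \<Rightarrow> ('v \<Rightarrow> complex) mat \<Rightarrow> complex"
  where "evaluation n A = (\<lambda>f\<in>Q_set V n. mat_pairing n f A)"

lemma zero_in_Q_set:
  assumes "0 < n"
  shows "0\<^sub>m n n \<in> Q_set V n"
proof -
  have "mat_star (dual_star V) (0\<^sub>m n n) = 0\<^sub>m n n"
    by (rule eq_matI) (auto simp: dual_star_def)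
  then have "0\<^sub>m n n \<in> mat_sa (dual_star V) n"
    by (simp add: mat_sa_def)
  then show ?thesis
    using norm_nonneg[OF assms] mat_dual_zero by (simp add: Q_set_iff[OF assms] dual_cone_def pairing_zero_left)
qed

lemma wstar_linear_extension_unique:
  assumes "0 < n" "is_wstar_linear_extension V n a b" "is_wstar_linear_extension V n a b'"
  shows "b = b'"
proof (rule extensionalityI)
  show "b \<in> extensional (mat_dual V n)" "b' \<in> extensional (mat_dual V n)"
    using assms by (simp_all add: is_wstar_linear_extension_def)
  fix f assume f: "f \<in> mat_dual V n"
  have "b f - b' f = 0"
  proof (rule Q_set_spans_mat_dual[OF assms(1) _ _ _ f, of "\<lambda>f. b f - b' f"])
    show "b (f + g) - b' (f + g) = b f - b' f + (b g - b' g)" if "f \<in> mat_dual V n" "g \<in> mat_dual V n" for f g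
      using assms(2,3) that by (simp add: is_wstar_linear_extension_def)
    show "b (map_mat (dual_scale c) f) - b' (map_mat (dual_scale c) f) = c * (b f - b' f)" if "f \<in> mat_dual V n" for c f
      using assms(2,3) that by (simp add: is_wstar_linear_extension_def right_diff_distrib)
    show "b f - b' f = 0" if "f \<in> Q_set V n" for f
      using assms(2,3) that by (simp add: is_wstar_linear_extension_def)
  qed
  then show "b f = b' f"
    by simp
qed

lemma evaluation_extension:
  assumes "0 < n" "A \<in> carrier_mat n n"
  shows "is_wstar_linear_extension V n (evaluation n A) (\<lambda>f\<in>mat_dual V n. mat_pairing n f A)"
  unfolding is_wstar_linear_extension_def evaluation_def
  using continuous_map_pairing[OF assms(2)] mat_dual_carrier[of _ n]
  by (simp add: mat_dual_add mat_dual_scale pairing_add_left[of _ n] pairing_scale_left[of _ n] Q_set_mat_dual)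

lemma A0_ext_evaluation:
  assumes "0 < n" "A \<in> carrier_mat n n" "f \<in> mat_dual V n"
  shows "A0_ext V n (evaluation n A) f = mat_pairing n f A"
proof -
  have "A0_ext V n (evaluation n A) = (\<lambda>f\<in>mat_dual V n. mat_pairing n f A)"
    unfolding A0_ext_def
    using evaluation_extension[OF assms(1,2)] wstar_linear_extension_unique[OF assms(1)]
    by (intro the_equality) blast+
  then show ?thesis
    using assms(3) by simp
qed

lemma evaluation_in_A0:
  assumes "0 < n" "A \<in> carrier_mat n n"
  shows "evaluation n A \<in> A0 V n"
proof -
  have "continuous_map (subtopology (wstar_topology V n) (Q_set V n)) euclidean (evaluation n A)"
  proof (rule continuous_map_eq)
    show "continuous_map (subtopology (wstar_topology V n) (Q_set V n)) euclidean
        (\<lambda>f\<in>mat_dual V n. mat_pairing n f A)"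
      by (rule continuous_map_from_subtopology[OF continuous_map_pairing[OF assms(2)]])
    fix f assume "f \<in> topspace (subtopology (wstar_topology V n) (Q_set V n))"
    then show "(\<lambda>f\<in>mat_dual V n. mat_pairing n f A) f = evaluation n A f"
      by (simp add: topspace_wstar evaluation_def)
  qed
  moreover have "evaluation n A (map_mat (dual_scale (complex_of_real (1 - t))) f + map_mat (dual_scale (complex_of_real t)) g)
      = complex_of_real (1 - t) * evaluation n A f + complex_of_real t * evaluation n A g"
    if "f \<in> Q_set V n" "g \<in> Q_set V n" "0 \<le> t" "t \<le> 1" for f g t
    using Q_set_convex[OF assms(1) that] that(1,2) mat_dual_carrier[OF Q_set_mat_dual]
    by (simp add: evaluation_def pairing_add_left[of _ n] pairing_scale_left[of _ n])
  moreover have "evaluation n A (0\<^sub>m n n) = 0"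
    using zero_in_Q_set[OF assms(1)] by (simp add: evaluation_def pairing_zero_left)
  moreover have "\<exists>!b. is_wstar_linear_extension V n (evaluation n A) b"
    using evaluation_extension[OF assms] wstar_linear_extension_unique[OF assms(1)] by blast
  moreover have "evaluation n A \<in> extensional (Q_set V n)"
    by (simp add: evaluation_def)
  ultimately show ?thesis
    unfolding A0_def by blast
qed

lemma A0_is_evaluation:
  assumes "a \<in> A0 V n"
  shows "\<exists>A\<in>carrier_mat n n. a = evaluation n A"
proof -
  obtain b where b: "is_wstar_linear_extension V n a b"
    using assms by (auto simp: A0_def)
  have "\<exists>B\<in>carrier_mat n n. \<forall>f\<in>mat_dual V n. b f = mat_pairing n f B"
    using b by (intro wstar_continuous_linear_is_pairing) (simp_all add: is_wstar_linear_extension_def)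
  then obtain B where B: "B \<in> carrier_mat n n" "\<And>f. f \<in> mat_dual V n \<Longrightarrow> b f = mat_pairing n f B"
    by blast
  have "a = evaluation n B"
  proof (rule extensionalityI)
    show "a \<in> extensional (Q_set V n)" "evaluation n B \<in> extensional (Q_set V n)"
      using assms by (simp_all add: A0_def evaluation_def)
    fix f assume "f \<in> Q_set V n"
    then show "a f = evaluation n B f"
      using b B(2)[OF Q_set_mat_dual] by (simp add: evaluation_def is_wstar_linear_extension_def)
  qed
  with B(1) show ?thesis
    by blast
qed

lemma evaluation_inj:
  assumes "0 < n"
  shows "inj_on (evaluation n) (carrier_mat n n)"
proof (rule inj_onI)
  fix A B :: "'v mat" assume A: "A \<in> carrier_mat n n" and B: "B \<in> carrier_mat n n"
    and eq: "evaluation n A = evaluation n B"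
  have mB: "- B \<in> carrier_mat n n"
    using B by simp
  have "A + - B = 0\<^sub>m n n"
  proof (rule Q_set_separates_points[OF assms])
    show "A + - B \<in> carrier_mat n n"
      using A B by simp
    fix f assume f: "f \<in> Q_set V n"
    have "mat_pairing n f A = mat_pairing n f B"
      using fun_cong[OF eq, of f] f by (simp add: evaluation_def)
    then show "mat_pairing n f (A + - B) = 0"
      using pairing_add_right[OF Q_set_mat_dual[OF f] A mB] pairing_uminus_right[OF Q_set_mat_dual[OF f] B] by simp
  qed
  show "A = B"
  proof (rule eq_matI)
    fix i j assume ij: "i < dim_row B" "j < dim_col B"
    then have "(A + - B) $$ (i, j) = 0"
      unfolding \<open>A + - B = 0\<^sub>m n n\<close> using B by simp
    then show "A $$ (i, j) = B $$ (i, j)"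
      using ij A B by simp
  qed (use A B in auto)
qed

lemma evaluation_bij:
  assumes "0 < n"
  shows "bij_betw (evaluation n) (carrier_mat n n) (A0 V n)"
  unfolding bij_betw_def
proof (intro conjI evaluation_inj assms subset_antisym)
  show "evaluation n ` carrier_mat n n \<subseteq> A0 V n"
    using evaluation_in_A0[OF assms] by blast
  show "A0 V n \<subseteq> evaluation n ` carrier_mat n n"
    using A0_is_evaluation[of _ n] by blast
qed

lemma evaluation_star:
  assumes "A \<in> carrier_mat n n"
  shows "A0_star V n (evaluation n A) = evaluation n (mat_star (vstar V) A)"
  unfolding A0_star_def evaluation_def
  using pairing_star_right[OF dual_cone_mat_sa assms]
  by (intro restrict_ext) (simp add: Q_set_def)

lemma mat11_bij: "bij_betw mat11 (UNIV :: 'v set) (carrier_mat 1 1)"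
proof (rule bij_betwI[of _ _ _ "\<lambda>A. A $$ (0, 0)"])
  show "mat11 (A $$ (0, 0)) = A" if "A \<in> carrier_mat 1 1" for A :: "'v mat"
    using that by (intro eq_matI) (auto simp: mat11_def)
qed auto

lemma Gamma_eq_evaluation: "Gamma V v = evaluation 1 (mat11 v)"
  by (simp add: Gamma_def evaluation_def mat_pairing_def mat11_def)

lemma Gamma_bij: "bij_betw (Gamma V) UNIV (A0 V 1)"
proof -
  have "bij_betw (evaluation 1 \<circ> mat11) (UNIV :: 'v set) (A0 V 1)"
    by (rule bij_betw_trans[OF mat11_bij evaluation_bij]) simp
  moreover have "evaluation 1 \<circ> mat11 = Gamma V"
    by (rule ext) (simp add: Gamma_eq_evaluation)
  ultimately show ?thesis
    by simp
qed

lemma A0_ident_Gamma: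
  assumes "A \<in> carrier_mat n n"
  shows "A0_ident V n (map_mat (Gamma V) A) = evaluation n A"
  unfolding A0_ident_def evaluation_def
proof (rule restrict_ext)
  fix f assume f: "f \<in> Q_set V n"
  have "A0_ext V 1 (map_mat (Gamma V) A $$ (i, j)) (mat11 (f $$ (i, j))) = (f $$ (i, j)) (A $$ (i, j))"
    if ij: "i < n" "j < n" for i j
  proof -
    have "mat11 (f $$ (i, j)) \<in> mat_dual V 1"
      using mat_dual_entry[OF Q_set_mat_dual[OF f] ij] by (simp add: mat_dual_def)
    then have "A0_ext V 1 (evaluation 1 (mat11 (A $$ (i, j)))) (mat11 (f $$ (i, j)))
        = mat_pairing 1 (mat11 (f $$ (i, j))) (mat11 (A $$ (i, j)))"
      by (intro A0_ext_evaluation) simp_all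
    then show ?thesis
      using assms ij by (simp add: Gamma_eq_evaluation mat_pairing_def)
  qed
  then show "(\<Sum>i<n. \<Sum>j<n. A0_ext V 1 (map_mat (Gamma V) A $$ (i, j)) (mat11 (f $$ (i, j)))) = mat_pairing n f A"
    unfolding mat_pairing_def by (intro sum.cong) auto
qed

lemma map_mat_Gamma_bij: "bij_betw (map_mat (Gamma V)) (carrier_mat n n) (mat_A0 V n)"
proof (rule bij_betwI[of _ _ _ "map_mat (inv_into UNIV (Gamma V))"])
  have surj: "Gamma V (inv_into UNIV (Gamma V) a) = a" if "a \<in> A0 V 1" for a
    using that Gamma_bij by (intro f_inv_into_f) (simp add: bij_betw_def)
  have inj: "inv_into UNIV (Gamma V) (Gamma V v) = v" for v
    using Gamma_bij by (intro inv_f_f) (simp add: bij_betw_def)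
  show "map_mat (Gamma V) \<in> carrier_mat n n \<rightarrow> mat_A0 V n"
    using Gamma_bij by (auto simp: mat_A0_def bij_betw_def)
  show "map_mat (inv_into UNIV (Gamma V)) \<in> mat_A0 V n \<rightarrow> carrier_mat n n"
    by (auto simp: mat_A0_def)
  show "map_mat (inv_into UNIV (Gamma V)) (map_mat (Gamma V) A) = A" if "A \<in> carrier_mat n n" for A
    using that by (intro eq_matI) (auto simp: inj)
  show "map_mat (Gamma V) (map_mat (inv_into UNIV (Gamma V)) a) = a" if "a \<in> mat_A0 V n" for a
    using that by (intro eq_matI) (auto simp: surj mat_A0_def)
qed

lemma A0_ident_bij:
  assumes "0 < n"
  shows "bij_betw (A0_ident V n) (mat_A0 V n) (A0 V n)"
proof -
  have "bij_betw (A0_ident V n \<circ> map_mat (Gamma V)) (carrier_mat n n) (A0 V n)"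
    using evaluation_bij[OF assms] by (rule bij_betw_cong[THEN iffD1, rotated]) (simp add: A0_ident_Gamma)
  then show ?thesis
    using bij_betw_comp_iff[OF map_mat_Gamma_bij] by blast
qed

lemma map_mat_Gamma_positive:
  assumes "0 < n"
  shows "map_mat (Gamma V) ` mcone V n \<subseteq> mat_A0_cone V n"
proof clarify
  fix A assume A: "A \<in> mcone V n"
  have Ac: "A \<in> carrier_mat n n" and sa: "mat_star (vstar V) A = A"
    using A cone_sa[OF assms] by (auto simp: mat_sa_def)
  have "evaluation n A f \<in> \<real>\<^sub>\<ge>\<^sub>0" if "f \<in> Q_set V n" for f
    using that A by (simp add: evaluation_def Q_set_def dual_cone_def)
  then have "evaluation n A \<in> A0_cone V n"
    using evaluation_in_A0[OF assms Ac] evaluation_star[OF Ac] sa by (simp add: A0_cone_def)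
  then show "map_mat (Gamma V) A \<in> mat_A0_cone V n"
    using bij_betwE[OF map_mat_Gamma_bij[of n]] Ac by (simp add: mat_A0_cone_def A0_ident_Gamma)
qed

lemma inv_map_mat_Gamma_positive:
  assumes "0 < n"
  shows "inv_into (carrier_mat n n) (map_mat (Gamma V)) ` mat_A0_cone V n \<subseteq> mcone V n"
proof clarify
  fix a assume a: "a \<in> mat_A0_cone V n"
  then have "a \<in> map_mat (Gamma V) ` carrier_mat n n"
    using map_mat_Gamma_bij[of n] by (simp add: bij_betw_def mat_A0_cone_def)
  then obtain A where A: "A \<in> carrier_mat n n" "a = map_mat (Gamma V) A"
    by blast
  have inv: "inv_into (carrier_mat n n) (map_mat (Gamma V)) a = A"
    unfolding A(2) using map_mat_Gamma_bij[of n] A(1) by (intro inv_into_f_f) (simp_all add: bij_betw_def)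
  have cone: "evaluation n A \<in> A0_cone V n"
    using a A by (simp add: mat_A0_cone_def A0_ident_Gamma)
  have star_carrier: "mat_star (vstar V) A \<in> carrier_mat n n"
    using A(1) by simp
  have "evaluation n (mat_star (vstar V) A) = evaluation n A"
    using cone evaluation_star[OF A(1)] by (simp add: A0_cone_def)
  then have "mat_star (vstar V) A = A"
    using inj_onD[OF evaluation_inj[OF assms] _ star_carrier A(1)] by simp
  then have sa: "A \<in> mat_sa (vstar V) n"
    using A(1) by (simp add: mat_sa_def)
  have nonneg: "0 \<le> Re (mat_pairing n f A)" if f: "f \<in> Q_set V n" for f
  proof -
    have "evaluation n A f \<in> \<real>\<^sub>\<ge>\<^sub>0"
      using cone f by (simp add: A0_cone_def)
    then show ?thesis
      using f by (simp add: evaluation_def complex_nonneg_Reals_iff)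
  qed
  have "A \<in> mcone V n"
  proof (rule ccontr)
    assume "A \<notin> mcone V n"
    then obtain f where "f \<in> Q_set V n" "Re (mat_pairing n f A) < 0"
      using Q_set_separates_cone[OF assms sa] by blast
    then show False
      using nonneg[of f] by simp
  qed
  then show "inv_into (carrier_mat n n) (map_mat (Gamma V)) a \<in> mcone V n"
    by (simp add: inv)
qed

end

section \<open>The norm at level 2n\<close>

definition permutation_mat :: "nat \<Rightarrow> (nat \<Rightarrow> nat) \<Rightarrow> complex mat"
  where "permutation_mat m \<pi> = Matrix.mat m m (\<lambda>(i, k). if k = \<pi> i then 1 else 0)"

lemma euclidean_norm_vec_nonneg: "0 \<le> euclidean_norm_vec x"
  by (simp add: euclidean_norm_vec_def L2_set_nonneg)

lemma euclidean_norm_permutation_mat: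
  assumes \<pi>: "bij_betw \<pi> {..<m} {..<m}" and x: "x \<in> carrier_vec m"
  shows "euclidean_norm_vec (permutation_mat m \<pi> *\<^sub>v x) = euclidean_norm_vec x"
proof -
  have dim: "dim_vec x = m" "dim_vec (permutation_mat m \<pi> *\<^sub>v x) = m"
    using x by (auto simp: permutation_mat_def)
  have entry: "vec_index (permutation_mat m \<pi> *\<^sub>v x) i = vec_index x (\<pi> i)" if i: "i < m" for i
  proof -
    have "\<pi> i < m"
      using bij_betwE[OF \<pi>] i by auto
    have "vec_index (permutation_mat m \<pi> *\<^sub>v x) i = (\<Sum>k = 0..<m. (if k = \<pi> i then 1 else 0) * vec_index x k)"
      using i dim by (simp add: permutation_mat_def scalar_prod_def)
    also have "\<dots> = (\<Sum>k = 0..<m. if k = \<pi> i then vec_index x k else 0)"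
      by (intro sum.cong) auto
    also have "\<dots> = vec_index x (\<pi> i)"
      using \<open>\<pi> i < m\<close> by simp
    finally show ?thesis .
  qed
  have "(\<Sum>i<m. (cmod (vec_index (permutation_mat m \<pi> *\<^sub>v x) i))\<^sup>2) = (\<Sum>i<m. (cmod (vec_index x (\<pi> i)))\<^sup>2)"
    by (intro sum.cong) (simp_all add: entry)
  also have "\<dots> = (\<Sum>i<m. (cmod (vec_index x i))\<^sup>2)"
    by (rule sum.reindex_bij_betw[OF \<pi>])
  finally show ?thesis
    unfolding euclidean_norm_vec_def L2_set_def dim by simp
qed

lemma scalar_mat_norm_permutation_mat:
  assumes \<pi>: "bij_betw \<pi> {..<m} {..<m}"
  shows "0 \<le> scalar_mat_norm (permutation_mat m \<pi>)" and "scalar_mat_norm (permutation_mat m \<pi>) \<le> 1"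
proof -
  let ?S = "{euclidean_norm_vec (permutation_mat m \<pi> *\<^sub>v x) |x.
    x \<in> carrier_vec (dim_col (permutation_mat m \<pi>)) \<and> euclidean_norm_vec x \<le> 1}"
  have dim: "dim_col (permutation_mat m \<pi>) = m"
    by (simp add: permutation_mat_def)
  have le: "s \<le> 1" if "s \<in> ?S" for s
  proof -
    from that obtain x where "s = euclidean_norm_vec (permutation_mat m \<pi> *\<^sub>v x)" "x \<in> carrier_vec m"
      "euclidean_norm_vec x \<le> 1"
      unfolding dim by blast
    then show ?thesis
      by (simp add: euclidean_norm_permutation_mat[OF \<pi>])
  qed
  have "euclidean_norm_vec (0\<^sub>v m) = 0"
    by (simp add: euclidean_norm_vec_def L2_set_def)
  then have mem: "euclidean_norm_vec (permutation_mat m \<pi> *\<^sub>v 0\<^sub>v m) \<in> ?S"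
    unfolding dim by (intro CollectI exI[of _ "0\<^sub>v m"]) simp
  have "bdd_above ?S"
    using le by (rule bdd_aboveI)
  from order_trans[OF euclidean_norm_vec_nonneg cSup_upper[OF mem this]]
  show "0 \<le> scalar_mat_norm (permutation_mat m \<pi>)"
    by (simp only: scalar_mat_norm_def)
  have "?S \<noteq> {}"
    using mem by blast
  from cSup_least[OF this le] show "scalar_mat_norm (permutation_mat m \<pi>) \<le> 1"
    by (simp only: scalar_mat_norm_def)
qed

lemma sum_lessThan_add: "(\<Sum>i<n + m. g i) = (\<Sum>i<n. g i) + (\<Sum>i<m. g (n + i :: nat) :: 'a :: comm_monoid_add)"
  by (induction m) (simp_all add: ac_simps)

lemma pairing_four_block:
  assumes "f11 \<in> carrier_mat n n" "f12 \<in> carrier_mat n n" "f21 \<in> carrier_mat n n" "f22 \<in> carrier_mat n n"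
    and "A11 \<in> carrier_mat n n" "A12 \<in> carrier_mat n n" "A21 \<in> carrier_mat n n" "A22 \<in> carrier_mat n n"
  shows "mat_pairing (2 * n) (four_block_mat f11 f12 f21 f22) (four_block_mat A11 A12 A21 A22)
    = mat_pairing n f11 A11 + mat_pairing n f12 A12 + (mat_pairing n f21 A21 + mat_pairing n f22 A22)"
  using assms unfolding mult_2 mat_pairing_def sum_lessThan_add
  by (simp add: sum.distrib)

context cstar_ordered_operator_space
begin

lemma norm_permute_rows_le:
  assumes "0 < m" "X \<in> carrier_mat m m" and \<pi>: "bij_betw \<pi> {..<m} {..<m}"
  shows "mnorm V m (block m (\<lambda>(i, j). X $$ (\<pi> i, j))) \<le> mnorm V m X"
proof -
  let ?P = "permutation_mat m \<pi>" and ?I = "permutation_mat m (\<lambda>i. i)"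
  have carrier: "?P \<in> carrier_mat m m" "?I \<in> carrier_mat m m"
    by (simp_all add: permutation_mat_def)
  have "scalar_mult_right V (scalar_mult_left V ?P X) ?I = block m (\<lambda>(i, j). X $$ (\<pi> i, j))"
  proof (rule eq_matI)
    fix i j assume "i < dim_row (block m (\<lambda>(i, j). X $$ (\<pi> i, j)))" "j < dim_col (block m (\<lambda>(i, j). X $$ (\<pi> i, j)))"
    then have ij: "i < m" "j < m"
      by auto
    have \<pi>i: "\<pi> i < m"
      using bij_betwE[OF \<pi>] ij(1) by auto
    have left: "(\<Sum>k<m. vscale V (?P $$ (i, k)) (X $$ (k, l))) = X $$ (\<pi> i, l)" for l
    proof -
      have "(\<Sum>k<m. vscale V (?P $$ (i, k)) (X $$ (k, l))) = (\<Sum>k<m. if k = \<pi> i then X $$ (k, l) else 0)"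
        using ij by (intro sum.cong) (auto simp: permutation_mat_def)
      then show ?thesis
        using \<pi>i by simp
    qed
    have "(\<Sum>l<m. vscale V (?I $$ (l, j)) (X $$ (\<pi> i, l))) = (\<Sum>l<m. if l = j then X $$ (\<pi> i, l) else 0)"
      using ij by (intro sum.cong) (auto simp: permutation_mat_def)
    then have right: "(\<Sum>l<m. vscale V (?I $$ (l, j)) (X $$ (\<pi> i, l))) = X $$ (\<pi> i, j)"
      using ij by simp
    show "scalar_mult_right V (scalar_mult_left V ?P X) ?I $$ (i, j) = block m (\<lambda>(i, j). X $$ (\<pi> i, j)) $$ (i, j)"
      using ij assms(2) carrier by (simp add: scalar_mult_right_def scalar_mult_left_def left right)
  qed (use assms(2) carrier in \<open>auto simp: scalar_mult_right_def scalar_mult_left_def\<close>)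
  then have "mnorm V m (block m (\<lambda>(i, j). X $$ (\<pi> i, j)))
      \<le> scalar_mat_norm ?P * mnorm V m X * scalar_mat_norm ?I"
    using norm_scalar_mult[OF assms(1) carrier assms(2)] by simp
  also have "\<dots> \<le> 1 * mnorm V m X * 1"
    using scalar_mat_norm_permutation_mat[OF \<pi>] scalar_mat_norm_permutation_mat[of "\<lambda>i. i" m]
      norm_nonneg[OF assms(1,2)]
    by (intro mult_mono mult_nonneg_nonneg) (auto simp: bij_betw_def)
  finally show ?thesis
    by simp
qed

text \<open>
  Exchanging the two halves of the rows turns the off-diagonal matrix into \<open>A\<^sup>* \<oplus> A\<close>, whose norm is
  \<open>max \<parallel>A\<^sup>*\<parallel> \<parallel>A\<parallel> = \<parallel>A\<parallel>\<close>.
\<close>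

lemma norm_off_diagonal:
  assumes "0 < n" "A \<in> carrier_mat n n"
  shows "mnorm V (2 * n) (four_block_mat (0\<^sub>m n n) A (mat_star (vstar V) A) (0\<^sub>m n n)) = mnorm V n A"
    (is "mnorm V (2 * n) ?B = _")
proof -
  let ?S = "mat_star (vstar V) A"
  let ?D = "four_block_mat ?S (0\<^sub>m n n) (0\<^sub>m n n) A"
  define \<pi> where "\<pi> = (\<lambda>i. if i < n then i + n else i - n)"
  have S: "?S \<in> carrier_mat n n"
    using assms(2) by simp
  have \<pi>: "bij_betw \<pi> {..<2 * n} {..<2 * n}"
    by (rule bij_betwI[of _ _ _ \<pi>]) (auto simp: \<pi>_def)
  have carrier: "?B \<in> carrier_mat (2 * n) (2 * n)" "?D \<in> carrier_mat (2 * n) (2 * n)"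
    using assms(2) by (auto simp: mult_2)
  have B: "block (2 * n) (\<lambda>(i, j). ?D $$ (\<pi> i, j)) = ?B"
    by (rule eq_matI) (use assms S in \<open>auto simp: \<pi>_def\<close>)
  have D: "block (2 * n) (\<lambda>(i, j). ?B $$ (\<pi> i, j)) = ?D"
    by (rule eq_matI) (use assms S in \<open>auto simp: \<pi>_def\<close>)
  have pos: "0 < 2 * n"
    using assms(1) by simp
  have "mnorm V (2 * n) ?B = mnorm V (2 * n) ?D"
    using norm_permute_rows_le[OF pos carrier(2) \<pi>] norm_permute_rows_le[OF pos carrier(1) \<pi>]
    unfolding B D by (rule antisym)
  also have "\<dots> = mnorm V n A"
    using norm_direct_sum[OF assms(1) assms(1) S assms(2)] star_isometry[OF assms] by (simp add: mult_2)
  finally show ?thesis .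
qed

lemma Q_set_blocks:
  assumes "0 < n" "F \<in> Q_set V (2 * n)"
  obtains f11 f12 f22 where "f11 \<in> carrier_mat n n" "f12 \<in> carrier_mat n n" "f22 \<in> carrier_mat n n"
    "F = four_block_mat f11 f12 (mat_star (dual_star V) f12) f22"
proof -
  have F: "F \<in> carrier_mat (2 * n) (2 * n)" "mat_star (dual_star V) F = F"
    using assms(2) by (auto simp: Q_set_def dual_cone_def mat_sa_def)
  \<comment> \<open>\<open>g a b\<close> is the \<open>n \<times> n\<close> block of \<open>F\<close> with upper left entry \<open>(a, b)\<close>\<close>
  define g where "g = (\<lambda>a b. Matrix.mat n n (\<lambda>(i, j). F $$ (i + a, j + b)))"
  have g: "g a b \<in> carrier_mat n n" for a b
    by (simp add: g_def)
  have "F = four_block_mat (g 0 0) (g 0 n) (mat_star (dual_star V) (g 0 n)) (g n n)"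
  proof (rule eq_matI)
    fix i j assume "i < dim_row (four_block_mat (g 0 0) (g 0 n) (mat_star (dual_star V) (g 0 n)) (g n n))"
      "j < dim_col (four_block_mat (g 0 0) (g 0 n) (mat_star (dual_star V) (g 0 n)) (g n n))"
    then have ij: "i < 2 * n" "j < 2 * n"
      using g by (simp_all add: g_def)
    have "F $$ (i, j) = dual_star V (F $$ (j, i))"
      using arg_cong[OF F(2), of "\<lambda>M. M $$ (i, j)"] F(1) ij by simp
    then show "F $$ (i, j) = four_block_mat (g 0 0) (g 0 n) (mat_star (dual_star V) (g 0 n)) (g n n) $$ (i, j)"
      using ij by (auto simp: g_def)
  qed (use F(1) in \<open>auto simp: g_def\<close>)
  with g[of 0 0] g[of 0 n] g[of n n] show thesis
    by (rule that)
qed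

lemma off_diagonal_block_mat_dual:
  assumes "four_block_mat f11 f12 f21 f22 \<in> mat_dual V (2 * n)"
    and "f11 \<in> carrier_mat n n" "f12 \<in> carrier_mat n n" "f22 \<in> carrier_mat n n"
  shows "f12 \<in> mat_dual V n"
proof -
  have "f12 $$ (i, j) \<in> dual_space V" if "i < n" "j < n" for i j
    using mat_dual_entry[OF assms(1), of i "j + n"] that assms by simp
  then show ?thesis
    using assms(3) by (simp add: mat_dual_def)
qed

text \<open>
  The quantity in the definition of the norm is the pairing of an element of \<open>Q\<^sub>2\<^sub>n(V)\<close> with the
  self-adjoint off-diagonal matrix of \<open>A\<close>. Since \<open>Q\<^sub>2\<^sub>n(V)\<close> is norming on self-adjoint elements, the
  supremum is attained and equals the norm of that matrix, which is \<open>\<parallel>A\<parallel>\<close>.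
\<close>

lemma mat_A0_norm_Gamma:
  assumes "0 < n" "A \<in> carrier_mat n n"
  shows "mat_A0_norm V n (map_mat (Gamma V) A) = mnorm V n A"
proof -
  let ?S = "mat_star (vstar V) A"
  let ?B = "four_block_mat (0\<^sub>m n n) A ?S (0\<^sub>m n n)"
  let ?s = "mat_star (dual_star V)"
  have S: "?S \<in> carrier_mat n n"
    using assms(2) by simp
  have pos: "0 < 2 * n"
    using assms(1) by simp
  have B: "?B \<in> carrier_mat (2 * n) (2 * n)"
    using assms(2) by (simp add: mult_2)
  have "mat_star (vstar V) ?B = ?B"
    by (rule eq_matI) (use assms in \<open>auto simp: star_star\<close>)
  then have B_sa: "?B \<in> mat_sa (vstar V) (2 * n)"
    using B by (simp add: mat_sa_def)
  have norm_term: "cmod (A0_ext V n (evaluation n A) f12 + A0_ext V n (A0_star V n (evaluation n A)) (?s f12))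
      = cmod (mat_pairing (2 * n) (four_block_mat f11 f12 (?s f12) f22) ?B)"
    if f: "f11 \<in> carrier_mat n n" "f12 \<in> carrier_mat n n" "f22 \<in> carrier_mat n n"
      and Q: "four_block_mat f11 f12 (?s f12) f22 \<in> Q_set V (2 * n)" for f11 f12 f22
  proof -
    have f12: "f12 \<in> mat_dual V n"
      by (rule off_diagonal_block_mat_dual[OF Q_set_mat_dual[OF Q] f])
    have sf12: "?s f12 \<in> carrier_mat n n"
      using f(2) by simp
    have "A0_ext V n (evaluation n A) f12 + A0_ext V n (A0_star V n (evaluation n A)) (?s f12)
        = mat_pairing n f12 A + mat_pairing n (?s f12) ?S"
      unfolding evaluation_star[OF assms(2)] A0_ext_evaluation[OF assms f12]
        A0_ext_evaluation[OF assms(1) S mat_dual_star[OF f12]] ..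
    also have "\<dots> = mat_pairing (2 * n) (four_block_mat f11 f12 (?s f12) f22) ?B"
    proof -
      have "mat_pairing n f11 (0\<^sub>m n n) = 0" "mat_pairing n f22 (0\<^sub>m n n) = 0"
      proof -
        have "f11 $$ (i, j) \<in> dual_space V" "f22 $$ (i, j) \<in> dual_space V" if "i < n" "j < n" for i j
          using mat_dual_entry[OF Q_set_mat_dual[OF Q], of i j]
            mat_dual_entry[OF Q_set_mat_dual[OF Q], of "i + n" "j + n"] that f by simp_all
        then have "f11 \<in> mat_dual V n" "f22 \<in> mat_dual V n"
          using f by (simp_all add: mat_dual_def)
        then show "mat_pairing n f11 (0\<^sub>m n n) = 0" "mat_pairing n f22 (0\<^sub>m n n) = 0"
          by (simp_all add: pairing_zero_right)
      qed
      then show ?thesis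
        by (simp add: pairing_four_block[OF f(1,2) sf12 f(3) zero_carrier_mat assms(2) S zero_carrier_mat])
    qed
    finally show ?thesis
      by simp
  qed
  let ?R = "{cmod (A0_ext V n (evaluation n A) f12 + A0_ext V n (A0_star V n (evaluation n A)) (?s f12)) |f11 f12 f22.
      f11 \<in> carrier_mat n n \<and> f12 \<in> carrier_mat n n \<and> f22 \<in> carrier_mat n n \<and>
      four_block_mat f11 f12 (?s f12) f22 \<in> Q_set V (2 * n)}"
  obtain F where F: "F \<in> Q_set V (2 * n)" "cmod (mat_pairing (2 * n) F ?B) = mnorm V (2 * n) ?B"
    using Q_set_norming[OF pos B_sa] by blast
  obtain f11 f12 f22 where f: "f11 \<in> carrier_mat n n" "f12 \<in> carrier_mat n n" "f22 \<in> carrier_mat n n"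
    "F = four_block_mat f11 f12 (?s f12) f22"
    by (rule Q_set_blocks[OF assms(1) F(1)])
  have "Sup ?R = mnorm V (2 * n) ?B"
  proof (rule cSup_eq_maximum)
    have "mnorm V (2 * n) ?B
        = cmod (A0_ext V n (evaluation n A) f12 + A0_ext V n (A0_star V n (evaluation n A)) (?s f12))"
      using norm_term[OF f(1-3)] F f(4) by simp
    then show "mnorm V (2 * n) ?B \<in> ?R"
      using f(1-3) F(1) unfolding f(4) by blast
    fix r assume "r \<in> ?R"
    then obtain g11 g12 g22 where g: "g11 \<in> carrier_mat n n" "g12 \<in> carrier_mat n n" "g22 \<in> carrier_mat n n"
      and Q: "four_block_mat g11 g12 (?s g12) g22 \<in> Q_set V (2 * n)"
      and r: "r = cmod (A0_ext V n (evaluation n A) g12 + A0_ext V n (A0_star V n (evaluation n A)) (?s g12))"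
      by blast
    have "cmod (mat_pairing (2 * n) (four_block_mat g11 g12 (?s g12) g22) ?B) \<le> mnorm V (2 * n) ?B"
      using Q B by (simp add: Q_set_iff[OF pos])
    then show "r \<le> mnorm V (2 * n) ?B"
      unfolding r norm_term[OF g Q] .
  qed
  then show ?thesis
    unfolding mat_A0_norm_def A0_ident_Gamma[OF assms(2)] A0_norm_def norm_off_diagonal[OF assms] .
qed

end

theorem theorem2p5:
  fixes V :: "('v::ab_group_add) matrix_space"
  assumes "cstar_ordered_operator_space V"
  shows "bij_betw (Gamma V) UNIV (A0 V 1)
    \<and> (\<forall>v w. Gamma V (v + w) = (\<lambda>f\<in>Q_set V 1. Gamma V v f + Gamma V w f))
    \<and> (\<forall>c v. Gamma V (vscale V c v) = (\<lambda>f\<in>Q_set V 1. c * Gamma V v f))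
    \<and> (\<forall>v. Gamma V (vstar V v) = A0_star V 1 (Gamma V v))
    \<and> (\<forall>n>0. bij_betw (A0_ident V n) (mat_A0 V n) (A0 V n)
        \<and> (\<forall>A\<in>carrier_mat n n. mat_A0_norm V n (map_mat (Gamma V) A) = mnorm V n A)
        \<and> map_mat (Gamma V) ` mcone V n \<subseteq> mat_A0_cone V n
        \<and> inv_into (carrier_mat n n) (map_mat (Gamma V)) ` mat_A0_cone V n \<subseteq> mcone V n)"
proof -
  interpret cstar_ordered_operator_space V
    by (rule assms)
  have entry: "f $$ (0, 0) \<in> dual_space V" if "f \<in> Q_set V 1" for f
    using mat_dual_entry[OF Q_set_mat_dual[OF that]] by simp
  have star11: "mat_star (vstar V) (mat11 v) = mat11 (vstar V v)" for v
    by (rule eq_matI) (simp_all add: mat11_def mat_star_def)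
  show ?thesis
  proof (intro conjI allI impI ballI)
    show "Gamma V (v + w) = (\<lambda>f\<in>Q_set V 1. Gamma V v f + Gamma V w f)" for v w
      unfolding Gamma_def by (rule restrict_ext) (simp add: dual_space_add[OF entry])
    show "Gamma V (vscale V c v) = (\<lambda>f\<in>Q_set V 1. c * Gamma V v f)" for c v
      unfolding Gamma_def by (rule restrict_ext) (simp add: dual_space_scale[OF entry])
    show "Gamma V (vstar V v) = A0_star V 1 (Gamma V v)" for v
      unfolding Gamma_eq_evaluation using evaluation_star[of "mat11 v" 1] star11 by simp
  qed (simp_all only: Gamma_bij A0_ident_bij mat_A0_norm_Gamma map_mat_Gamma_positive inv_map_mat_Gamma_positive)
qed

end
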